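(* Let $\mathcal A$ be a $\sigma$-unital C*-algebra and let $T\in\mathcal M(\mathcal A)_+$. Then for every $\epsilon>0$ there exist a bi-diagonal series $\sum_{k=1}^\infty d_k$ and a self-adjoint element $a_\epsilon\in\mathcal A$ with $\|a_\epsilon\|<\epsilon$ such that $$T=\sum_{k=1}^\infty d_k+a_\epsilon.$$ Furthermore, the $d_k$ can be chosen in $\mathrm{Ped}(\mathcal A)$ and such that, for a fixed (given in advance) approximate identity $\{e_n\}_{n=1}^\infty$ of $\mathcal A$ with $e_{n+1}e_n=e_n$ for all $n$, for every $n\in\mathbb N$ there is an $N\in\mathbb N$ for which $e_n\sum_{k=N}^\infty d_k=0$.
   Context: $\mathcal M(\mathcal A)$ is the multiplier algebra of $\mathcal A$. A series $\sum_{k=1}^\infty d_k$ with $d_k\in\mathcal A_+$ is called bi-diagonal if it converges in the strict topology of $\mathcal M(\mathcal A)$ and $d_nd_m=0$ whenever $|n-m|\ge2$. $\mathrm{Ped}(\mathcal A)$ is the Pedersen ideal of $\mathcal A$ (the minimal norm-dense two-sided ideal). Approximate identities $\{e_n\}$ are understood to be increasing sequences of positive contractions; a $\sigma$-unital C*-algebra always has one satisfying $e_{n+1}e_n=e_n$ for all $n$. *)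

theory Defs
  imports "HOL-Analysis.Analysis"
begin

text \<open>Not necessarily unital, not necessarily non-zero.\<close>

class cstar_algebra = real_normed_algebra + banach +
  fixes scaleC :: "complex \<Rightarrow> 'a \<Rightarrow> 'a" (infixr "*\<^sub>C" 75)
    and star :: "'a \<Rightarrow> 'a"
  assumes scaleC_add_right: "c *\<^sub>C (x + y) = c *\<^sub>C x + c *\<^sub>C y"
    and scaleC_add_left: "(c + d) *\<^sub>C x = c *\<^sub>C x + d *\<^sub>C x"
    and scaleC_scaleC: "c *\<^sub>C d *\<^sub>C x = (c * d) *\<^sub>C x"
    and scaleC_of_real: "complex_of_real r *\<^sub>C x = r *\<^sub>R x"
    and mult_scaleC_left: "(c *\<^sub>C x) * y = c *\<^sub>C (x * y)"
    and mult_scaleC_right: "x * (c *\<^sub>C y) = c *\<^sub>C (x * y)"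
    and norm_scaleC: "norm (c *\<^sub>C x) = cmod c * norm x"
    and star_star: "star (star x) = x"
    and star_add: "star (x + y) = star x + star y"
    and star_scaleC: "star (c *\<^sub>C x) = cnj c *\<^sub>C star x"
    and star_mult: "star (x * y) = star y * star x"
    and norm_star_mult_self: "norm (star x * x) = (norm x)\<^sup>2"

definition selfadjoint :: "'a::cstar_algebra \<Rightarrow> bool" where
  "selfadjoint a \<longleftrightarrow> star a = a"

text \<open>
  The pair \<open>(x, \<alpha>)\<close> stands for the element \<open>x + \<alpha> 1\<close> of the algebra obtained by adjoining a new
  unit, so that \<open>(0, 1)\<close> is the unit. The spectrum is taken there, also if the algebra already
  has a unit; in that case it is the usual spectrum together with \<open>0\<close>, which makes no difference
  for positivity.
\<close>

definition unitization_mult ::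
    "'a::cstar_algebra \<times> complex \<Rightarrow> 'a \<times> complex \<Rightarrow> 'a \<times> complex" where
  "unitization_mult = (\<lambda>(x, \<alpha>) (y, \<beta>). (x * y + \<alpha> *\<^sub>C y + \<beta> *\<^sub>C x, \<alpha> * \<beta>))"

definition spectrum :: "'a::cstar_algebra \<Rightarrow> complex set" where
  "spectrum a = {z. \<not> (\<exists>u. unitization_mult (a, - z) u = (0, 1) \<and>
                          unitization_mult u (a, - z) = (0, 1))}"

definition positive_element :: "'a::cstar_algebra \<Rightarrow> bool" where
  "positive_element a \<longleftrightarrow> selfadjoint a \<and> spectrum a \<subseteq> complex_of_real ` {0..}"

definition two_sided_ideal :: "'a::cstar_algebra set \<Rightarrow> bool" where
  "two_sided_ideal I \<longleftrightarrow>
     0 \<in> I \<and> (\<forall>x\<in>I. \<forall>y\<in>I. x + y \<in> I) \<and> (\<forall>c. \<forall>x\<in>I. c *\<^sub>C x \<in> I) \<and>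
     (\<forall>a. \<forall>x\<in>I. a * x \<in> I \<and> x * a \<in> I)"

text \<open>By Pedersen's theorem this intersection is itself dense, so it is the least dense ideal.\<close>

definition pedersen_ideal :: "'a::cstar_algebra set" where
  "pedersen_ideal = \<Inter>{I. two_sided_ideal I \<and> closure I = UNIV}"

definition approximate_identity :: "(nat \<Rightarrow> 'a::cstar_algebra) \<Rightarrow> bool" where
  "approximate_identity e \<longleftrightarrow>
     (\<forall>n. positive_element (e n) \<and> norm (e n) \<le> 1) \<and>
     (\<forall>m n. m \<le> n \<longrightarrow> positive_element (e n - e m)) \<and>
     (\<forall>a. (\<lambda>n. e n * a) \<longlonglongrightarrow> a \<and> (\<lambda>n. a * e n) \<longlonglongrightarrow> a)"

definition sigma_unital :: "'a::cstar_algebra itself \<Rightarrow> bool" where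
  "sigma_unital _ \<longleftrightarrow> (\<exists>e :: nat \<Rightarrow> 'a. approximate_identity e)"

lemma norm_star: "norm (star x) = norm (x :: 'a::cstar_algebra)"
proof -
  have *: "norm y \<le> norm (star y)" for y :: 'a
  proof (cases "norm y = 0")
    case False
    have "norm y * norm y \<le> norm (star y) * norm y"
      using norm_star_mult_self[of y] norm_mult_ineq[of "star y" y] by (simp add: power2_eq_square)
    then show ?thesis by (rule mult_right_le_imp_le) (use False in simp)
  qed simp
  from *[of x] *[of "star x"] show ?thesis by (simp add: star_star)
qed

lemma star_scaleR: "star (r *\<^sub>R x) = r *\<^sub>R star (x :: 'a::cstar_algebra)"
  using star_scaleC[of "of_real r" x] by (simp add: scaleC_of_real)

lemma bounded_linear_star: "bounded_linear (star :: 'a::cstar_algebra \<Rightarrow> 'a)"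
  by (rule bounded_linear_intro[where K = 1]) (simp_all add: star_add star_scaleR norm_star)

lemma scaleR_scaleC_commute: "r *\<^sub>R c *\<^sub>C x = c *\<^sub>C r *\<^sub>R (x :: 'a::cstar_algebra)"
  by (simp add: scaleC_of_real[symmetric] scaleC_scaleC mult.commute)

lemma bounded_linear_scaleC: "bounded_linear (\<lambda>x :: 'a::cstar_algebra. c *\<^sub>C x)"
  by (rule bounded_linear_intro[where K = "cmod c"])
    (simp_all add: scaleC_add_right norm_scaleC scaleR_scaleC_commute mult.commute)

lemma mult_left_eqI:
  fixes x y :: "'a::cstar_algebra"
  assumes "\<And>a. a * x = a * y"
  shows "x = y"
proof -
  have "star (x - y) * (x - y) = 0" using assms by (simp add: right_diff_distrib)
  then have "(norm (x - y))\<^sup>2 = 0" using norm_star_mult_self[of "x - y"] by simp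
  then show ?thesis by simp
qed

lemma scaleC_zero_right [simp]: "c *\<^sub>C 0 = (0 :: 'a::cstar_algebra)"
  using bounded_linear_scaleC linear_0 bounded_linear.linear by blast

lemma scaleC_minus_right: "c *\<^sub>C (- x) = - (c *\<^sub>C (x :: 'a::cstar_algebra))"
  using bounded_linear_scaleC[of c] linear_neg bounded_linear.linear by blast

lemma scaleC_diff_right: "c *\<^sub>C (x - y) = c *\<^sub>C x - c *\<^sub>C (y :: 'a::cstar_algebra)"
  using bounded_linear_scaleC[of c] linear_diff bounded_linear.linear by blast

lemma norm_le_of_left_mult:
  fixes y :: "'a::cstar_algebra"
  assumes "0 \<le> K" "\<And>b. norm (b * y) \<le> K * norm b"
  shows "norm y \<le> K"
proof (cases "norm y = 0")
  case False
  have "norm y * norm y \<le> K * norm y"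
    using assms(2)[of "star y"] by (simp add: norm_star_mult_self power2_eq_square norm_star)
  then show ?thesis by (rule mult_right_le_imp_le) (use False in simp)
qed (use assms in simp)

text \<open>
  Multipliers are double centralizers \<open>(L, R)\<close>: \<open>L a\<close> and \<open>R a\<close> are the products
  of the multiplier with \<open>a\<close> from the left and from the right, respectively.
\<close>

definition double_centralizer :: "('a::cstar_algebra \<Rightarrow>\<^sub>L 'a) \<Rightarrow> ('a \<Rightarrow>\<^sub>L 'a) \<Rightarrow> bool" where
  "double_centralizer L R \<longleftrightarrow>
      (\<forall>c a. L (c *\<^sub>C a) = c *\<^sub>C L a) \<and> (\<forall>c a. R (c *\<^sub>C a) = c *\<^sub>C R a) \<and>
      (\<forall>a b. L (a * b) = L a * b) \<and> (\<forall>a b. R (a * b) = a * R b) \<and>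
      (\<forall>a b. R a * b = a * L b)"

typedef (overloaded) 'a multiplier =
  "{(L :: 'a::cstar_algebra \<Rightarrow>\<^sub>L 'a, R :: 'a \<Rightarrow>\<^sub>L 'a). double_centralizer L R}"
  by (intro exI[of _ "(0, 0)"]) (simp add: double_centralizer_def)

definition lmul :: "'a::cstar_algebra multiplier \<Rightarrow> 'a \<Rightarrow>\<^sub>L 'a" where
  "lmul x = fst (Rep_multiplier x)"

definition rmul :: "'a::cstar_algebra multiplier \<Rightarrow> 'a \<Rightarrow>\<^sub>L 'a" where
  "rmul x = snd (Rep_multiplier x)"

lemma double_centralizer_parts: "double_centralizer (lmul x) (rmul x)"
  using Rep_multiplier[of x] unfolding lmul_def rmul_def by (auto split: prod.splits)

lemma
  assumes "double_centralizer L R"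
  shows lmul_Abs: "lmul (Abs_multiplier (L, R)) = L"
    and rmul_Abs: "rmul (Abs_multiplier (L, R)) = R"
  using Abs_multiplier_inverse[of "(L, R)"] assms unfolding lmul_def rmul_def by auto

lemma lmul_scaleC: "lmul x (c *\<^sub>C a) = c *\<^sub>C lmul x a"
  and rmul_scaleC: "rmul x (c *\<^sub>C a) = c *\<^sub>C rmul x a"
  and lmul_mult: "lmul x (a * b) = lmul x a * b"
  and rmul_mult: "rmul x (a * b) = a * rmul x b"
  and rmul_lmul: "rmul x a * b = a * lmul x b"
  using double_centralizer_parts[of x] unfolding double_centralizer_def by blast+

lemma multiplier_eqI:
  assumes "\<And>a. lmul x a = lmul y a" "\<And>a. rmul x a = rmul y a"
  shows "x = y"
proof -
  have "lmul x = lmul y" "rmul x = rmul y" using assms by (auto intro: blinfun_eqI)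
  then show ?thesis unfolding lmul_def rmul_def
    by (simp add: prod_eq_iff flip: Rep_multiplier_inject)
qed

lemma norm_rmul: "norm (rmul x) = norm (lmul x)"
proof (rule antisym)
  show "norm (rmul x) \<le> norm (lmul x)"
  proof (rule norm_blinfun_bound)
    fix a
    have "norm (b * star (rmul x a)) \<le> norm (lmul x) * norm a * norm b" for b
    proof -
      have "norm (b * star (rmul x a)) = norm (rmul x a * star b)"
        using norm_star[of "b * star (rmul x a)"] by (simp add: star_mult star_star)
      also have "\<dots> \<le> norm a * norm (lmul x (star b))"
        by (simp add: rmul_lmul norm_mult_ineq)
      also have "\<dots> \<le> norm a * (norm (lmul x) * norm b)"
        using norm_blinfun[of "lmul x" "star b"] by (simp add: norm_star mult_left_mono)
      finally show ?thesis by (simp add: ac_simps)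
    qed
    then have "norm (star (rmul x a)) \<le> norm (lmul x) * norm a"
      by (rule norm_le_of_left_mult[rotated]) simp
    then show "norm (rmul x a) \<le> norm (lmul x) * norm a" by (simp add: norm_star)
  qed simp
  show "norm (lmul x) \<le> norm (rmul x)"
  proof (rule norm_blinfun_bound)
    fix a
    have "norm (b * lmul x a) \<le> norm (rmul x) * norm a * norm b" for b
    proof -
      have "norm (b * lmul x a) \<le> norm (rmul x b) * norm a"
        by (simp add: rmul_lmul[symmetric] norm_mult_ineq)
      also have "\<dots> \<le> norm (rmul x) * norm b * norm a"
        by (intro mult_right_mono norm_blinfun) auto
      finally show ?thesis by (simp add: ac_simps)
    qed
    then show "norm (lmul x a) \<le> norm (rmul x) * norm a"
      by (rule norm_le_of_left_mult[rotated]) simp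
  qed simp
qed

lift_definition star_blinfun :: "'a::cstar_algebra \<Rightarrow>\<^sub>L 'a" is star
  by (rule bounded_linear_star)

lift_definition scaleC_blinfun :: "complex \<Rightarrow> 'a::cstar_algebra \<Rightarrow>\<^sub>L 'a" is "\<lambda>c x. c *\<^sub>C x"
  by (rule bounded_linear_scaleC)

declare star_blinfun.rep_eq [simp] scaleC_blinfun.rep_eq [simp]

instantiation multiplier :: (cstar_algebra) real_normed_vector
begin

definition zero_multiplier :: "'a multiplier" where
  "0 = Abs_multiplier (0, 0)"

definition plus_multiplier :: "'a multiplier \<Rightarrow> 'a multiplier \<Rightarrow> 'a multiplier" where
  "x + y = Abs_multiplier (lmul x + lmul y, rmul x + rmul y)"

definition uminus_multiplier :: "'a multiplier \<Rightarrow> 'a multiplier" where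
  "- x = Abs_multiplier (- lmul x, - rmul x)"

definition minus_multiplier :: "'a multiplier \<Rightarrow> 'a multiplier \<Rightarrow> 'a multiplier" where
  "x - y = Abs_multiplier (lmul x - lmul y, rmul x - rmul y)"

definition scaleR_multiplier :: "real \<Rightarrow> 'a multiplier \<Rightarrow> 'a multiplier" where
  "r *\<^sub>R x = Abs_multiplier (r *\<^sub>R lmul x, r *\<^sub>R rmul x)"

text \<open>The operator norms of the two components coincide, see \<open>norm_rmul\<close>.\<close>

definition norm_multiplier :: "'a multiplier \<Rightarrow> real" where
  "norm x = norm (lmul x)"

definition "sgn (x :: 'a multiplier) = inverse (norm x) *\<^sub>R x"

definition "dist x (y :: 'a multiplier) = norm (x - y)"

definition "(uniformity :: ('a multiplier \<times> 'a multiplier) filter) =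
  (INF e\<in>{0 <..}. principal {(x, y). dist x y < e})"

definition "open (U :: 'a multiplier set) \<longleftrightarrow>
  (\<forall>x\<in>U. \<forall>\<^sub>F (x', y) in uniformity. x' = x \<longrightarrow> y \<in> U)"

lemma double_centralizer_ops:
  "double_centralizer (0 :: 'a \<Rightarrow>\<^sub>L 'a) 0"
  "double_centralizer (lmul x + lmul y) (rmul x + rmul y)"
  "double_centralizer (- lmul x) (- rmul x)"
  "double_centralizer (lmul x - lmul y) (rmul x - rmul y)"
  "double_centralizer (r *\<^sub>R lmul x) (r *\<^sub>R rmul x)"
  for x y :: "'a multiplier"
  unfolding double_centralizer_def
  by (simp_all add: lmul_scaleC rmul_scaleC lmul_mult rmul_mult rmul_lmul
      blinfun.add_left blinfun.minus_left blinfun.diff_left blinfun.scaleR_left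
      scaleC_add_right scaleC_minus_right scaleC_diff_right scaleR_scaleC_commute
      distrib_left distrib_right left_diff_distrib right_diff_distrib)

lemmas multiplier_ops_defs = zero_multiplier_def plus_multiplier_def uminus_multiplier_def
  minus_multiplier_def scaleR_multiplier_def

lemma lmul_simps [simp]:
  "lmul 0 = (0 :: 'a \<Rightarrow>\<^sub>L 'a)"
  "lmul (x + y) = lmul x + lmul y"
  "lmul (- x) = - lmul x"
  "lmul (x - y) = lmul x - lmul y"
  "lmul (r *\<^sub>R x) = r *\<^sub>R lmul x"
  for x y :: "'a multiplier"
  unfolding multiplier_ops_defs by (rule lmul_Abs double_centralizer_ops)+

lemma rmul_simps [simp]:
  "rmul 0 = (0 :: 'a \<Rightarrow>\<^sub>L 'a)"
  "rmul (x + y) = rmul x + rmul y"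
  "rmul (- x) = - rmul x"
  "rmul (x - y) = rmul x - rmul y"
  "rmul (r *\<^sub>R x) = r *\<^sub>R rmul x"
  for x y :: "'a multiplier"
  unfolding multiplier_ops_defs by (rule rmul_Abs double_centralizer_ops)+

instance
proof
  fix x y z :: "'a multiplier" and r s :: real
  note ext = blinfun.add_left blinfun.minus_left blinfun.diff_left blinfun.scaleR_left
    blinfun.add_right blinfun.minus_right blinfun.diff_right blinfun.scaleR_right
  show "dist x y = norm (x - y)" by (rule dist_multiplier_def)
  show "sgn x = inverse (norm x) *\<^sub>R x" by (rule sgn_multiplier_def)
  show "(uniformity :: ('a multiplier \<times> 'a multiplier) filter) =
      (INF e\<in>{0 <..}. principal {(x, y). dist x y < e})"
    by (rule uniformity_multiplier_def)
  show "open U \<longleftrightarrow> (\<forall>x\<in>U. \<forall>\<^sub>F (x', y) in uniformity. x' = x \<longrightarrow> y \<in> U)"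
    for U :: "'a multiplier set"
    by (rule open_multiplier_def)
  show "x + y + z = x + (y + z)" "x + y = y + x" "0 + x = x" "- x + x = 0" "x - y = x + - y"
    by (rule multiplier_eqI; simp add: ext)+
  show "r *\<^sub>R (x + y) = r *\<^sub>R x + r *\<^sub>R y" "(r + s) *\<^sub>R x = r *\<^sub>R x + s *\<^sub>R x"
    "r *\<^sub>R s *\<^sub>R x = (r * s) *\<^sub>R x" "1 *\<^sub>R x = x"
    by (rule multiplier_eqI; simp add: ext algebra_simps)+
  show "norm x = 0 \<longleftrightarrow> x = 0"
  proof
    assume "norm x = 0"
    then have "lmul x = 0" by (simp add: norm_multiplier_def)
    then have "rmul x = 0" using norm_rmul[of x] by simp
    with \<open>lmul x = 0\<close> show "x = 0" by (intro multiplier_eqI) auto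
  qed (simp add: norm_multiplier_def)
  show "norm (x + y) \<le> norm x + norm y" by (simp add: norm_multiplier_def norm_triangle_ineq)
  show "norm (r *\<^sub>R x) = \<bar>r\<bar> * norm x" by (simp add: norm_multiplier_def)
qed

end

instantiation multiplier :: (cstar_algebra) real_normed_algebra
begin

definition times_multiplier :: "'a multiplier \<Rightarrow> 'a multiplier \<Rightarrow> 'a multiplier" where
  "x * y = Abs_multiplier (lmul x o\<^sub>L lmul y, rmul y o\<^sub>L rmul x)"

lemma double_centralizer_times:
  "double_centralizer (lmul x o\<^sub>L lmul y) (rmul y o\<^sub>L rmul x)" for x y :: "'a multiplier"
  unfolding double_centralizer_def
  by (simp add: lmul_scaleC rmul_scaleC lmul_mult rmul_mult rmul_lmul)

lemma lmul_times [simp]: "lmul (x * y) = lmul x o\<^sub>L lmul y"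
  and rmul_times [simp]: "rmul (x * y) = rmul y o\<^sub>L rmul x" for x y :: "'a multiplier"
  unfolding times_multiplier_def by (rule lmul_Abs rmul_Abs double_centralizer_times)+

instance
proof
  fix x y z :: "'a multiplier" and r :: real
  show "x * y * z = x * (y * z)"
    by (rule multiplier_eqI) simp_all
  show "(x + y) * z = x * z + y * z" "x * (y + z) = x * y + x * z"
    by (rule multiplier_eqI, simp_all add: blinfun.add_left blinfun.add_right)+
  show "r *\<^sub>R x * y = r *\<^sub>R (x * y)" "x * r *\<^sub>R y = r *\<^sub>R (x * y)"
    by (rule multiplier_eqI, simp_all add: blinfun.scaleR_left blinfun.scaleR_right)+
  show "norm (x * y) \<le> norm x * norm y"
    by (simp add: norm_multiplier_def norm_blinfun_compose)
qed

end

lemma convergent_Cauchy_multiplier: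
  fixes X :: "nat \<Rightarrow> 'a::cstar_algebra multiplier"
  assumes "Cauchy X"
  shows "convergent X"
proof -
  have nl: "norm (lmul x - lmul y) = dist x y" for x y :: "'a multiplier"
    by (simp add: dist_norm norm_multiplier_def)
  have nr: "norm (rmul x - rmul y) = dist x y" for x y :: "'a multiplier"
    using norm_rmul[of "x - y"] nl[of x y] by simp
  have "Cauchy (\<lambda>n. lmul (X n))" "Cauchy (\<lambda>n. rmul (X n))"
    using assms unfolding Cauchy_def by (simp_all add: dist_norm[of "lmul _"] dist_norm[of "rmul _"] nl nr)
  then obtain L R where L: "(\<lambda>n. lmul (X n)) \<longlonglongrightarrow> L" and R: "(\<lambda>n. rmul (X n)) \<longlonglongrightarrow> R"
    by (auto simp: Cauchy_convergent_iff convergent_def)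
  have L': "(\<lambda>n. lmul (X n) a) \<longlonglongrightarrow> L a" and R': "(\<lambda>n. rmul (X n) a) \<longlonglongrightarrow> R a" for a
    by (intro blinfun.tendsto L R tendsto_const)+
  note sC = bounded_linear.tendsto[OF bounded_linear_scaleC]
  have "double_centralizer L R"
    unfolding double_centralizer_def
  proof (intro conjI allI)
    show "L (c *\<^sub>C a) = c *\<^sub>C L a" for c a
      by (rule LIMSEQ_unique[OF L']) (simp add: lmul_scaleC sC[OF L'])
    show "R (c *\<^sub>C a) = c *\<^sub>C R a" for c a
      by (rule LIMSEQ_unique[OF R']) (simp add: rmul_scaleC sC[OF R'])
    show "L (a * b) = L a * b" for a b
      by (rule LIMSEQ_unique[OF L']) (simp add: lmul_mult tendsto_mult[OF L' tendsto_const])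
    show "R (a * b) = a * R b" for a b
      by (rule LIMSEQ_unique[OF R']) (simp add: rmul_mult tendsto_mult[OF tendsto_const R'])
    show "R a * b = a * L b" for a b
    proof (rule LIMSEQ_unique)
      show "(\<lambda>n. rmul (X n) a * b) \<longlonglongrightarrow> R a * b" by (rule tendsto_mult[OF R' tendsto_const])
      show "(\<lambda>n. rmul (X n) a * b) \<longlonglongrightarrow> a * L b"
        unfolding rmul_lmul by (rule tendsto_mult[OF tendsto_const L'])
    qed
  qed
  then have "lmul (Abs_multiplier (L, R)) = L" by (rule lmul_Abs)
  then have "(\<lambda>n. dist (X n) (Abs_multiplier (L, R))) \<longlonglongrightarrow> 0"
    using L by (simp add: nl[symmetric] LIM_zero tendsto_norm_zero)
  then have "X \<longlonglongrightarrow> Abs_multiplier (L, R)" by (rule tendsto_dist_iff[THEN iffD2])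
  then show ?thesis by (rule convergentI)
qed

instance multiplier :: (cstar_algebra) banach
  by standard (rule convergent_Cauchy_multiplier)

lemma norm_scaleC_blinfun_comp:
  "norm (scaleC_blinfun c o\<^sub>L F) = cmod c * norm (F :: 'a::cstar_algebra \<Rightarrow>\<^sub>L 'a)"
proof (rule antisym)
  have le: "norm (scaleC_blinfun c o\<^sub>L G) \<le> cmod c * norm G" for c and G :: "'a \<Rightarrow>\<^sub>L 'a"
  proof (rule norm_blinfun_bound)
    fix a
    have "cmod c * norm (G a) \<le> cmod c * (norm G * norm a)"
      by (intro mult_left_mono norm_blinfun) auto
    then show "norm ((scaleC_blinfun c o\<^sub>L G) a) \<le> cmod c * norm G * norm a"
      by (simp add: norm_scaleC mult.assoc)
  qed simp
  show "norm (scaleC_blinfun c o\<^sub>L F) \<le> cmod c * norm F" by (rule le)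
  show "cmod c * norm F \<le> norm (scaleC_blinfun c o\<^sub>L F)"
  proof (cases "c = 0")
    case False
    have "scaleC_blinfun (inverse c) o\<^sub>L (scaleC_blinfun c o\<^sub>L F) = F"
      using False scaleC_of_real[of 1] by (intro blinfun_eqI) (simp add: scaleC_scaleC)
    then have "norm F \<le> inverse (cmod c) * norm (scaleC_blinfun c o\<^sub>L F)"
      using le[of "inverse c" "scaleC_blinfun c o\<^sub>L F"] by (simp add: norm_inverse)
    then show ?thesis using False by (simp add: field_simps)
  qed simp
qed

instantiation multiplier :: (cstar_algebra) cstar_algebra
begin

definition scaleC_multiplier :: "complex \<Rightarrow> 'a multiplier \<Rightarrow> 'a multiplier" where
  "c *\<^sub>C x = Abs_multiplier (scaleC_blinfun c o\<^sub>L lmul x, scaleC_blinfun c o\<^sub>L rmul x)"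

definition star_multiplier :: "'a multiplier \<Rightarrow> 'a multiplier" where
  "star x = Abs_multiplier (star_blinfun o\<^sub>L rmul x o\<^sub>L star_blinfun,
                            star_blinfun o\<^sub>L lmul x o\<^sub>L star_blinfun)"

lemma double_centralizer_ops':
  "double_centralizer (scaleC_blinfun c o\<^sub>L lmul x) (scaleC_blinfun c o\<^sub>L rmul x)"
  "double_centralizer (star_blinfun o\<^sub>L rmul x o\<^sub>L star_blinfun)
                      (star_blinfun o\<^sub>L lmul x o\<^sub>L star_blinfun)"
  for x :: "'a multiplier"
proof -
  have "star (lmul x (star a)) * b = a * star (rmul x (star b))" for a b
  proof -
    have "star (star (lmul x (star a)) * b) = star (a * star (rmul x (star b)))"
      by (simp only: star_mult star_star rmul_lmul)
    then show ?thesis using star_star[of "star (lmul x (star a)) * b"] by (simp add: star_star)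
  qed
  then show "double_centralizer (star_blinfun o\<^sub>L rmul x o\<^sub>L star_blinfun)
                      (star_blinfun o\<^sub>L lmul x o\<^sub>L star_blinfun)"
    unfolding double_centralizer_def
    by (simp add: star_mult star_star star_scaleC lmul_scaleC rmul_scaleC lmul_mult rmul_mult)
  show "double_centralizer (scaleC_blinfun c o\<^sub>L lmul x) (scaleC_blinfun c o\<^sub>L rmul x)"
    unfolding double_centralizer_def
    by (simp add: lmul_scaleC rmul_scaleC lmul_mult rmul_mult rmul_lmul scaleC_scaleC
        mult_scaleC_left mult_scaleC_right mult.commute[of c])
qed

lemma lmul_rmul_simps [simp]:
  "lmul (c *\<^sub>C x) = scaleC_blinfun c o\<^sub>L lmul x"
  "lmul (star x) = star_blinfun o\<^sub>L rmul x o\<^sub>L star_blinfun"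
  "rmul (c *\<^sub>C x) = scaleC_blinfun c o\<^sub>L rmul x"
  "rmul (star x) = star_blinfun o\<^sub>L lmul x o\<^sub>L star_blinfun"
  for x :: "'a multiplier"
  unfolding scaleC_multiplier_def star_multiplier_def
  by (rule lmul_Abs rmul_Abs double_centralizer_ops')+

lemma norm_star_mult_self_multiplier: "norm (star x * x) = (norm x)\<^sup>2" for x :: "'a multiplier"
proof -
  let ?L = "lmul x" and ?P = "star_blinfun o\<^sub>L rmul x o\<^sub>L star_blinfun o\<^sub>L lmul x"
  have nP: "norm (star x * x) = norm ?P"
    by (simp add: norm_multiplier_def)
  have "norm ?P \<le> norm ?L * norm ?L"
  proof (rule norm_blinfun_bound)
    fix a
    have "norm (?P a) \<le> norm (rmul x) * norm (star (lmul x a))"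
      using norm_blinfun[of "rmul x" "star (lmul x a)"] by (simp add: norm_star)
    also have "\<dots> \<le> norm ?L * (norm ?L * norm a)"
      by (simp add: norm_star norm_rmul mult_left_mono norm_blinfun)
    finally show "norm (?P a) \<le> norm ?L * norm ?L * norm a" by (simp add: mult.assoc)
  qed simp
  moreover have "norm ?L \<le> sqrt (norm ?P)"
  proof (rule norm_blinfun_bound)
    fix a
    have "(norm (?L a))\<^sup>2 = norm (star (lmul x a) * lmul x a)"
      by (simp add: norm_star_mult_self)
    also have "star (lmul x a) * lmul x a = star (?P a) * a"
      by (simp add: star_star rmul_lmul)
    also have "norm \<dots> \<le> norm (star (?P a)) * norm a" by (rule norm_mult_ineq)
    also have "\<dots> \<le> norm ?P * norm a * norm a"
      unfolding norm_star by (intro mult_right_mono norm_blinfun) auto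
    finally have "(norm (?L a))\<^sup>2 \<le> (sqrt (norm ?P) * norm a)\<^sup>2"
      by (simp add: power_mult_distrib power2_eq_square ac_simps)
    then show "norm (?L a) \<le> sqrt (norm ?P) * norm a"
      by (rule power2_le_imp_le) simp
  qed simp
  then have "(norm ?L)\<^sup>2 \<le> norm ?P"
    using power_mono[of "norm ?L" "sqrt (norm ?P)" 2] by simp
  ultimately show ?thesis by (simp add: nP norm_multiplier_def power2_eq_square)
qed

instance
proof
  fix x y :: "'a multiplier" and r :: real and c d :: complex
  note ext = blinfun.add_left blinfun.scaleR_left blinfun.add_right blinfun.scaleR_right
  show "c *\<^sub>C (x + y) = c *\<^sub>C x + c *\<^sub>C y" "(c + d) *\<^sub>C x = c *\<^sub>C x + d *\<^sub>C x"
    "c *\<^sub>C d *\<^sub>C x = (c * d) *\<^sub>C x" "complex_of_real r *\<^sub>C x = r *\<^sub>R x"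
    "(c *\<^sub>C x) * y = c *\<^sub>C (x * y)" "x * (c *\<^sub>C y) = c *\<^sub>C (x * y)"
    by (rule multiplier_eqI; simp add: ext scaleC_add_right scaleC_add_left scaleC_scaleC
        scaleC_of_real lmul_scaleC rmul_scaleC)+
  show "norm (c *\<^sub>C x) = cmod c * norm x"
    by (simp add: norm_multiplier_def norm_scaleC_blinfun_comp)
  show "star (star x) = x" "star (x + y) = star x + star y" "star (c *\<^sub>C x) = cnj c *\<^sub>C star x"
    "star (x * y) = star y * star x"
    by (rule multiplier_eqI; simp add: ext star_star star_add star_scaleC)+
  show "norm (star x * x) = (norm x)\<^sup>2" by (rule norm_star_mult_self_multiplier)
qed

end

definition canonical :: "'a::cstar_algebra \<Rightarrow> 'a multiplier" where
  "canonical a = Abs_multiplier (Blinfun (\<lambda>b. a * b), Blinfun (\<lambda>b. b * a))"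

lemma double_centralizer_canonical:
  "double_centralizer (Blinfun (\<lambda>b. a * b)) (Blinfun (\<lambda>b. b * a))" for a :: "'a::cstar_algebra"
  unfolding double_centralizer_def
  by (simp add: bounded_linear_Blinfun_apply bounded_linear_mult_left bounded_linear_mult_right
      mult_scaleC_left mult_scaleC_right mult.assoc)

lemma lmul_canonical [simp]: "lmul (canonical a) b = a * b"
  and rmul_canonical [simp]: "rmul (canonical a) b = b * a"
  unfolding canonical_def
  by (simp_all add: lmul_Abs rmul_Abs double_centralizer_canonical bounded_linear_Blinfun_apply
      bounded_linear_mult_left bounded_linear_mult_right)

text \<open>The coarsest topology for which all the maps \<open>x \<mapsto> x a\<close> and \<open>x \<mapsto> a x\<close> into the
  algebra with its norm topology are continuous.\<close>

definition strict_topology :: "'a::cstar_algebra multiplier topology" where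
  "strict_topology = topology_generated_by
     ({{x. lmul x a \<in> U} | a U. open U} \<union> {{x. rmul x a \<in> U} | a U. open U})"

lemma limitin_strict_topology_iff:
  fixes S :: "'a::cstar_algebra multiplier"
  shows "limitin strict_topology X S F \<longleftrightarrow>
     (\<forall>a. ((\<lambda>n. lmul (X n) a) \<longlongrightarrow> lmul S a) F \<and> ((\<lambda>n. rmul (X n) a) \<longlongrightarrow> rmul S a) F)"
    (is "?lim \<longleftrightarrow> ?pointwise")
proof
  assume lim: ?lim
  have ev: "eventually (\<lambda>n. X n \<in> V) F" if "openin strict_topology V" "S \<in> V" for V
    using lim that unfolding limitin_def by blast
  have op: "openin strict_topology {x. lmul x a \<in> U}" "openin strict_topology {x. rmul x a \<in> U}"
    if "open U" for a :: 'a and U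
    using that unfolding strict_topology_def
    by (intro topology_generated_by_Basis; blast)+
  show ?pointwise
    unfolding tendsto_def using ev[OF op(1)] ev[OF op(2)] by simp
next
  assume *: ?pointwise
  have "eventually (\<lambda>n. X n \<in> V) F" if "openin strict_topology V" "S \<in> V" for V
  proof -
    have "generate_topology_on
        ({{x. lmul x a \<in> U} | a U. open U} \<union> {{x. rmul x a \<in> U} | a U. open U}) V"
      using that(1) by (simp add: strict_topology_def openin_topology_generated_by_iff)
    then show ?thesis using that(2)
    proof induction
      case (Int V W)
      then show ?case by (simp add: eventually_conj)
    next
      case (UN K)
      then obtain V where "V \<in> K" "S \<in> V" by blast
      with UN.IH[OF this] show ?case by (auto elim: eventually_mono)
    next
      case (Basis V)
      then show ?case using * unfolding tendsto_def by auto
    qed simp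
  qed
  moreover have "S \<in> topspace strict_topology"
  proof -
    have "UNIV \<in> {{x :: 'a multiplier. lmul x a \<in> U} | a U. open U}"
      by (intro CollectI exI[of _ 0] exI[of _ UNIV]) simp
    then show ?thesis
      unfolding strict_topology_def topology_generated_by_topspace by blast
  qed
  ultimately show ?lim by (simp add: limitin_def)
qed

definition strict_sums :: "(nat \<Rightarrow> 'a::cstar_algebra) \<Rightarrow> 'a multiplier \<Rightarrow> bool" where
  "strict_sums d S \<longleftrightarrow> limitin strict_topology (\<lambda>n. \<Sum>k<n. canonical (d k)) S sequentially"

definition bidiagonal_series :: "(nat \<Rightarrow> 'a::cstar_algebra) \<Rightarrow> bool" where
  "bidiagonal_series d \<longleftrightarrow>
     (\<forall>k. positive_element (d k)) \<and> (\<exists>S. strict_sums d S) \<and>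
     (\<forall>n m. \<bar>int n - int m\<bar> \<ge> 2 \<longrightarrow> d n * d m = 0)"

end

theory Submission
  imports Defs
begin

text \<open>
  Write \<open>T = X\<^sup>2\<close> with \<open>X\<close> self-adjoint in the multiplier algebra, and let \<open>f\<^sub>0 = 0, f\<^sub>1, f\<^sub>2, \<dots>\<close> be a
  subsequence, preceded by \<open>0\<close>, of an approximate identity with \<open>e\<^bsub>n+1\<^esub> e\<^sub>n = e\<^sub>n\<close>. The series
  \<open>T = \<Sum>\<^sub>k X (f\<^bsub>3k+3\<^esub> - f\<^bsub>3k\<^esub>) X\<close> converges strictly and has positive terms in the algebra, but its
  terms need not be orthogonal to each other. However, \<open>X f\<^sub>j\<close> lies in the algebra, so the subsequence
  can be chosen so sparse that \<open>(1 - f\<^bsub>j+1\<^esub>) X f\<^sub>j\<close> is as small as desired, and summable in \<open>j\<close>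
  (\<open>almost_commuting_subsequence\<close>). Taking adjoints as well, \<open>X (f\<^bsub>3k+3\<^esub> - f\<^bsub>3k\<^esub>)\<close> is almost unchanged
  by multiplication from the left with the window \<open>q\<^sub>k = f\<^bsub>3k+4\<^esub> - f\<^bsub>3k-1\<^esub>\<close>, where \<open>f\<^bsub>-1\<^esub>\<close> is read as \<open>0\<close>. So one sets
  \<open>d\<^sub>k = q\<^sub>k X (f\<^bsub>3k+3\<^esub> - f\<^bsub>3k\<^esub>) X q\<^sub>k\<close>, and the differences between the original terms and the \<open>d\<^sub>k\<close> sum
  up in norm to a small self-adjoint \<open>a\<close> in the algebra (\<open>bidiagonal_decomposition\<close>). Windows whose
  indices differ by at least two annihilate each other by the absorption \<open>f\<^sub>j f\<^sub>i = f\<^sub>i\<close> for \<open>i < j\<close>,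
  and every \<open>e\<^sub>n\<close> annihilates all late windows, for the same reason.

  The \<open>d\<^sub>k\<close> lie in the Pedersen ideal because the \<open>f\<^sub>j\<close> do: if \<open>a b = a\<close> and \<open>i\<close> is an element of a dense ideal
  with \<open>\<parallel>b - i\<parallel> < 1\<close>, then \<open>a (1 - (b - i)) = a i\<close>, and \<open>1 - (b - i)\<close> is invertible
  (\<open>mem_pedersen_ideal_of_absorbed\<close>).

  The first claim needs an absorbing approximate identity to exist. It is obtained from a strictly
  positive element \<open>h\<close> as a sequence of continuous cutoffs of \<open>h\<close>, which are built from positive and
  negative parts only (\<open>cutoff_sequence\<close>).

  The theory of positive elements is developed from norms and square roots. In a unital
  C*-algebra call an element nonnegative if it is the square of
  a self-adjoint element. By an iteration for the square root this is equivalent to the norm condition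
  \<open>\<parallel>t 1 - a\<parallel> \<le> t\<close> for some \<open>t\<close> (\<open>nonnegI\<close>, \<open>nonneg_norm_diff_le\<close>), which yields sums, limits and norm
  comparison. The link to the spectrum is \<open>nonneg_of_resolvent\<close>, and it gives that \<open>w\<^sup>* w\<close> is always
  nonnegative (\<open>nonneg_star_mult\<close>).
\<close>

section \<open>Unital C*-algebras\<close>

text \<open>
  The unit comes from \<open>monoid_mult\<close> and not from \<open>ring_1\<close>, because \<open>0 = 1\<close> in the multiplier algebra of the
  zero algebra.
\<close>

class cstar_algebra_1 = cstar_algebra + monoid_mult

lemma star_0 [simp]: "star (0 :: 'a::cstar_algebra) = 0"
  using star_scaleR[of 0 "0::'a"] by simp

lemma star_minus: "star (- x) = - star (x :: 'a::cstar_algebra)"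
  using star_scaleR[of "-1" x] by simp

lemma star_diff: "star (x - y) = star x - star (y :: 'a::cstar_algebra)"
  using star_add[of x "- y"] by (simp add: star_minus)

lemma star_one [simp]: "star (1 :: 'a::cstar_algebra_1) = 1"
  by (metis mult_1_left mult_1_right star_mult star_star)

lemma norm_one_le: "norm (1 :: 'a::cstar_algebra_1) \<le> 1"
proof -
  have "norm (1::'a) = (norm (1::'a))\<^sup>2" using norm_star_mult_self[of "1::'a"] by simp
  then show ?thesis by (auto simp: power2_eq_square)
qed

lemma norm_scaleR_one_le: "norm (r *\<^sub>R (1 :: 'a::cstar_algebra_1)) \<le> \<bar>r\<bar>"
  using mult_left_mono[OF norm_one_le, of "\<bar>r\<bar>"] by simp

lemma norm_sa_square: "star x = x \<Longrightarrow> norm (x * x) = (norm (x :: 'a::cstar_algebra))\<^sup>2"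
  using norm_star_mult_self[of x] by simp

lemma scaleC_ii_ii: "\<i> *\<^sub>C \<i> *\<^sub>C x = - (x :: 'a::cstar_algebra)"
  using scaleC_of_real[of "-1" x] by (simp add: scaleC_scaleC)

lemma scaleC_zero_left [simp]: "0 *\<^sub>C x = (0 :: 'a::cstar_algebra)"
  using scaleC_of_real[of 0 x] by simp

lemma scaleC_one [simp]: "1 *\<^sub>C x = (x :: 'a::cstar_algebra)"
  using scaleC_of_real[of 1 x] by simp

lemma scaleC_minus_left: "(- z) *\<^sub>C x = - (z *\<^sub>C (x :: 'a::cstar_algebra))"
  using scaleC_add_left[of "- z" z x] by (simp add: eq_neg_iff_add_eq_0)

lemma scaleC_ii_mult: "(\<i> *\<^sub>C x) * (\<i> *\<^sub>C y) = - (x * (y :: 'a::cstar_algebra))"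
  by (simp add: mult_scaleC_left mult_scaleC_right scaleC_ii_ii)

section \<open>Square roots and nonnegative elements\<close>

text \<open>
  The element \<open>y = 1 - sqrt (1 - x)\<close> is a fixed point of \<open>y \<mapsto> (x + y\<^sup>2) / 2\<close>. The iterates \<open>Y\<close> from
  \<open>0\<close> are polynomials in \<open>x\<close> with nonnegative coefficients, so their norms and those of their
  increments are bounded by the iterates \<open>s\<close> of the scalar recursion for \<open>x = 1\<close> and by the increments of
  \<open>s\<close>; this scalar sequence increases and is bounded by \<open>1\<close>. This gives convergence on the whole closed unit ball.
\<close>

lemma sqrt_one_minus:
  fixes x :: "'a::cstar_algebra_1"
  assumes sa: "star x = x" and le: "norm x \<le> 1"
  obtains y where "star y = y" "norm y \<le> 1" "(1 - y) * (1 - y) = 1 - x"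
    "\<And>z. x * z = z * x \<Longrightarrow> y * z = z * y"
proof -
  define Y where "Y = rec_nat (0::'a) (\<lambda>_ y. (1/2) *\<^sub>R (x + y * y))"
  define s where "s = rec_nat (0::real) (\<lambda>_ r. (1 + r * r) / 2)"
  have Y0 [simp]: "Y 0 = 0" and YS: "Y (Suc n) = (1/2) *\<^sub>R (x + Y n * Y n)" for n
    by (simp_all add: Y_def)
  have s0 [simp]: "s 0 = 0" and sS: "s (Suc n) = (1 + s n * s n) / 2" for n
    by (simp_all add: s_def)
  have s01: "0 \<le> s n \<and> s n \<le> 1" for n
  proof (induction n)
    case (Suc n)
    then have "s n * s n \<le> 1" using mult_mono[of "s n" 1 "s n" 1] by simp
    then show ?case by (simp add: sS)
  qed simp
  have s_inc: "s n \<le> s (Suc n)" for n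
    using zero_le_square[of "1 - s n"] by (simp add: sS algebra_simps)
  have comm: "Y n * z = z * Y n" if "x * z = z * x" for n z
  proof (induction n)
    case (Suc n)
    have "Y n * Y n * z = z * (Y n * Y n)" by (metis Suc mult.assoc)
    then show ?case using that by (simp add: YS distrib_left distrib_right)
  qed simp
  have Ysa: "star (Y n) = Y n" for n
    by (induction n) (simp_all add: YS star_scaleR star_add star_mult sa)
  have Yle: "norm (Y n) \<le> s n" for n
  proof (induction n)
    case (Suc n)
    have "norm (Y (Suc n)) \<le> (norm x + norm (Y n) * norm (Y n)) / 2"
      using norm_triangle_ineq[of x "Y n * Y n"] norm_mult_ineq[of "Y n" "Y n"] by (simp add: YS)
    also have "\<dots> \<le> s (Suc n)"
      using le mult_mono[OF Suc Suc] s01[of n] by (simp add: sS)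
    finally show ?case .
  qed simp
  have step: "norm (Y (Suc n) - Y n) \<le> s (Suc n) - s n" for n
  proof (induction n)
    case 0
    show ?case using le by (simp add: YS sS)
  next
    case (Suc n)
    have c: "Y (Suc n) * Y n = Y n * Y (Suc n)" by (intro comm comm[symmetric] refl)
    have "(1/2) *\<^sub>R (x + u * u) - (1/2) *\<^sub>R (x + v * v) = (1/2) *\<^sub>R ((u - v) * (u + v))"
      if "u * v = v * u" for u v
      using that by (simp add: algebra_simps)
    from this[OF c]
    have "Y (Suc (Suc n)) - Y (Suc n) = (1/2) *\<^sub>R ((Y (Suc n) - Y n) * (Y (Suc n) + Y n))"
      by (simp only: YS[of n, symmetric] YS[of "Suc n", symmetric])
    also have "norm \<dots> \<le> (1/2) * (norm (Y (Suc n) - Y n) * norm (Y (Suc n) + Y n))"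
      by (simp add: norm_mult_ineq)
    also have "\<dots> \<le> (1/2) * ((s (Suc n) - s n) * (s (Suc n) + s n))"
      using Suc Yle[of n] Yle[of "Suc n"] norm_triangle_ineq[of "Y (Suc n)" "Y n"] s_inc[of n]
      by (intro mult_left_mono mult_mono) auto
    also have "\<dots> = s (Suc (Suc n)) - s (Suc n)"
    proof -
      have "(1/2) * ((p - q) * (p + q)) = (1 + p * p) / 2 - (1 + q * q) / 2" for p q :: real
        by (simp add: field_simps)
      then show ?thesis by (simp only: sS[of n, symmetric] sS[of "Suc n", symmetric])
    qed
    finally show ?case .
  qed
  have tele: "norm (Y n - Y m) \<le> s n - s m" if "m \<le> n" for m n
    using that
  proof (induction n rule: dec_induct)
    case (step n)
    have "norm (Y (Suc n) - Y m) \<le> norm (Y (Suc n) - Y n) + norm (Y n - Y m)"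
      using norm_triangle_ineq[of "Y (Suc n) - Y n" "Y n - Y m"] by simp
    then show ?case using step \<open>\<And>n. norm (Y (Suc n) - Y n) \<le> s (Suc n) - s n\<close>[of n] by simp
  qed simp
  have "convergent s"
    by (rule Bseq_mono_convergent[OF BseqI'[of s 1]])
      (use s01 s_inc in \<open>auto intro: lift_Suc_mono_le\<close>)
  then have "Cauchy s" by (rule convergent_Cauchy)
  have "Cauchy Y"
  proof (rule metric_CauchyI)
    fix e :: real assume "0 < e"
    then obtain M where M: "\<And>m n. m \<ge> M \<Longrightarrow> n \<ge> M \<Longrightarrow> dist (s m) (s n) < e"
      using metric_CauchyD[OF \<open>Cauchy s\<close>] by blast
    have "dist (Y m) (Y n) < e" if "m \<ge> M" "n \<ge> M" for m n
    proof (cases "m \<le> n")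
      case True
      then show ?thesis using tele[of m n] M[OF that] by (simp add: dist_norm norm_minus_commute)
    next
      case False
      then show ?thesis using tele[of n m] M[OF that] by (simp add: dist_norm norm_minus_commute)
    qed
    then show "\<exists>M. \<forall>m\<ge>M. \<forall>n\<ge>M. dist (Y m) (Y n) < e" by blast
  qed
  then obtain y where y: "Y \<longlonglongrightarrow> y" by (auto simp: Cauchy_convergent_iff convergent_def)
  have "star y = y"
    using LIMSEQ_unique[OF bounded_linear.tendsto[OF bounded_linear_star y]] y by (simp add: Ysa)
  moreover have "norm y \<le> 1"
    by (rule LIMSEQ_le_const2[OF tendsto_norm[OF y]]) (meson Yle order_trans s01)
  moreover have "(1 - y) * (1 - y) = 1 - x"
  proof -
    have "(\<lambda>n. Y (Suc n)) \<longlonglongrightarrow> (1/2) *\<^sub>R (x + y * y)"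
      unfolding YS by (intro tendsto_intros y)
    with LIMSEQ_Suc[OF y] have "y = (1/2) *\<^sub>R (x + y * y)" by (rule LIMSEQ_unique)
    then have "2 *\<^sub>R y = 2 *\<^sub>R (1/2) *\<^sub>R (x + y * y)" by metis
    then have "y + y = x + y * y" by (simp add: scaleR_2)
    then show ?thesis by (simp add: algebra_simps)
  qed
  moreover have "y * z = z * y" if "x * z = z * x" for z
  proof (rule LIMSEQ_unique)
    show "(\<lambda>n. Y n * z) \<longlonglongrightarrow> y * z" by (intro tendsto_intros y)
    show "(\<lambda>n. Y n * z) \<longlonglongrightarrow> z * y" unfolding comm[OF that] by (intro tendsto_intros y)
  qed
  ultimately show ?thesis by (rule that)
qed

text \<open>
  This is the usual positivity, in a form that does not mention the spectrum; see
  \<open>positive_element_iff_nonneg\<close> and \<open>nonneg_of_positive_element\<close>.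
\<close>

definition nonneg :: "'a::cstar_algebra_1 \<Rightarrow> bool" where
  "nonneg a \<longleftrightarrow> (\<exists>s. star s = s \<and> a = s * s)"

lemma nonneg_sa: "nonneg a \<Longrightarrow> star a = a"
  by (auto simp: nonneg_def star_mult)

lemma nonneg_square: "star s = s \<Longrightarrow> nonneg (s * s)"
  by (auto simp: nonneg_def)

text \<open>
  For \<open>t > 0\<close> this is \<open>sqrt_one_minus\<close> for \<open>x = 1 - a / t\<close>. The norm bound on the root makes the root itself
  nonnegative, and the last property expresses that the root is a limit of polynomials in \<open>a\<close>.
\<close>

lemma sqrt_of_norm_bound:
  fixes a :: "'a::cstar_algebra_1"
  assumes sa: "star a = a" and le: "norm (t *\<^sub>R 1 - a) \<le> t"
  obtains s where "star s = s" "s * s = a" "norm (sqrt t *\<^sub>R 1 - s) \<le> sqrt t"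
    "\<And>z. a * z = z * a \<Longrightarrow> s * z = z * s"
proof -
  have t0: "0 \<le> t" using le norm_ge_zero order_trans by blast
  show ?thesis
  proof (cases "t = 0")
    case True
    then show ?thesis using le that[of 0] by simp
  next
    case False
    with t0 have t: "0 < t" by simp
    define x where "x = (1/t) *\<^sub>R (t *\<^sub>R 1 - a)"
    have "star x = x" by (simp add: x_def star_scaleR star_diff sa)
    moreover have "norm x \<le> 1" using le t by (simp add: x_def)
    ultimately obtain y where y: "star y = y" "norm y \<le> 1" "(1 - y) * (1 - y) = 1 - x"
      "\<And>z. x * z = z * x \<Longrightarrow> y * z = z * y" by (rule sqrt_one_minus) blast
    show ?thesis
    proof (rule that[of "sqrt t *\<^sub>R (1 - y)"])
      show "star (sqrt t *\<^sub>R (1 - y)) = sqrt t *\<^sub>R (1 - y)"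
        by (simp add: star_scaleR star_diff y)
      show "sqrt t *\<^sub>R (1 - y) * sqrt t *\<^sub>R (1 - y) = a"
      proof -
        have "sqrt t *\<^sub>R (1 - y) * sqrt t *\<^sub>R (1 - y) = t *\<^sub>R ((1 - y) * (1 - y))"
          using t0 by (simp only: mult_scaleR_left mult_scaleR_right scaleR_scaleR) simp
        also have "\<dots> = a" using t by (simp add: y(3) x_def scaleR_diff_right)
        finally show ?thesis .
      qed
      have "norm (sqrt t *\<^sub>R 1 - sqrt t *\<^sub>R (1 - y)) = sqrt t * norm y"
        using t by (simp add: scaleR_diff_right)
      also have "\<dots> \<le> sqrt t" using y(2) t by (simp add: mult_left_le)
      finally show "norm (sqrt t *\<^sub>R 1 - sqrt t *\<^sub>R (1 - y)) \<le> sqrt t" .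
      show "sqrt t *\<^sub>R (1 - y) * z = z * sqrt t *\<^sub>R (1 - y)" if "a * z = z * a" for z
      proof -
        have "x * z = z * x" using that by (simp add: x_def algebra_simps)
        then have "y * z = z * y" by (rule y(4))
        then show ?thesis by (simp add: algebra_simps)
      qed
    qed
  qed
qed

text \<open>
  The element \<open>z = x + \<i> y\<close> is \<open>sqrt t\<close> times a unitary: \<open>z\<^sup>* z = x\<^sup>2 + y\<^sup>2 = t 1\<close>. And \<open>x\<close> is the real part
  of \<open>z\<close>. In this way a sum of squares bounds its summands before any order is available.
\<close>

lemma norm_le_of_square_sum:
  fixes x y :: "'a::cstar_algebra_1"
  assumes sa: "star x = x" "star y = y" and comm: "x * y = y * x"
    and sum: "x * x + y * y = t *\<^sub>R 1" and t: "0 \<le> t"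
  shows "(norm x)\<^sup>2 \<le> t"
proof -
  define z where "z = x + \<i> *\<^sub>C y"
  have sz: "star z = x + (- \<i>) *\<^sub>C y" by (simp add: z_def star_add star_scaleC sa)
  then have sz': "star z = x - \<i> *\<^sub>C y" by (simp add: scaleC_minus_left)
  have "star z * z = x * x + y * y"
    unfolding sz' by (simp add: z_def algebra_simps mult_scaleC_left mult_scaleC_right comm
        scaleC_diff_right scaleC_add_right scaleC_ii_ii)
  then have "(norm z)\<^sup>2 \<le> t"
    using norm_star_mult_self[of z] norm_scaleR_one_le[of t, where 'a='a] sum t by simp
  moreover have "norm x \<le> norm z"
  proof -
    have "x + x = z + star z" unfolding sz' by (simp add: z_def)
    then have "2 *\<^sub>R x = z + star z" by (simp add: scaleR_2)
    then have "2 * norm x = norm (z + star z)" by (metis abs_numeral norm_scaleR)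
    then show ?thesis using norm_triangle_ineq[of z "star z"] by (simp add: norm_star)
  qed
  ultimately show ?thesis by (meson norm_ge_zero order_trans power_mono)
qed

text \<open>With \<open>y\<close> the root of \<open>t 1 - s\<^sup>2\<close>, the two squares \<open>y\<^sup>2\<close> and \<open>s\<^sup>2\<close> add up to \<open>t 1\<close>.\<close>

lemma norm_diff_square_le:
  fixes s :: "'a::cstar_algebra_1"
  assumes sa: "star s = s" and le: "(norm s)\<^sup>2 \<le> t"
  shows "norm (t *\<^sub>R 1 - s * s) \<le> t"
proof -
  have t: "0 \<le> t" using le zero_le_power2 order_trans by blast
  have "star (t *\<^sub>R 1 - s * s) = t *\<^sub>R 1 - s * s" by (simp add: star_diff star_scaleR star_mult sa)
  moreover have "norm (t *\<^sub>R 1 - (t *\<^sub>R 1 - s * s)) \<le> t" using le by (simp add: norm_sa_square sa)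
  ultimately obtain y where y: "star y = y" "y * y = t *\<^sub>R 1 - s * s"
    "\<And>z. (t *\<^sub>R 1 - s * s) * z = z * (t *\<^sub>R 1 - s * s) \<Longrightarrow> y * z = z * y"
    by (rule sqrt_of_norm_bound) blast
  have "y * s = s * y" by (rule y(3)) (simp add: algebra_simps)
  then have "(norm y)\<^sup>2 \<le> t" by (rule norm_le_of_square_sum[OF y(1) sa]) (simp_all add: y(2) t)
  then show ?thesis using norm_sa_square[OF y(1)] y(2) by simp
qed

lemma nonnegI:
  fixes a :: "'a::cstar_algebra_1"
  assumes "star a = a" "norm (t *\<^sub>R 1 - a) \<le> t"
  shows "nonneg a"
  using sqrt_of_norm_bound[OF assms] by (metis nonneg_def)

text \<open>
  Together with \<open>nonnegI\<close>: a self-adjoint \<open>a\<close> is nonnegative iff \<open>\<parallel>t 1 - a\<parallel> \<le> t\<close> for some \<open>t\<close>, and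
  then this holds for all \<open>t \<ge> \<parallel>a\<parallel>\<close>. Sums and limits preserve such bounds.
\<close>

lemma nonneg_norm_diff_le:
  fixes a :: "'a::cstar_algebra_1"
  assumes "nonneg a" "norm a \<le> t"
  shows "norm (t *\<^sub>R 1 - a) \<le> t"
  using assms norm_diff_square_le by (auto simp: nonneg_def norm_sa_square)

lemma nonneg_sqrt:
  fixes a :: "'a::cstar_algebra_1"
  assumes "nonneg a"
  obtains s where "nonneg s" "star s = s" "s * s = a" "\<And>z. a * z = z * a \<Longrightarrow> s * z = z * s"
proof -
  obtain s where s: "star s = s" "s * s = a" "norm (sqrt (norm a) *\<^sub>R 1 - s) \<le> sqrt (norm a)"
    "\<And>z. a * z = z * a \<Longrightarrow> s * z = z * s"
    using sqrt_of_norm_bound[OF nonneg_sa[OF assms] nonneg_norm_diff_le[OF assms order_refl]]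
    by blast
  then show ?thesis using that nonnegI[OF s(1,3)] by blast
qed

lemma nonneg_add:
  fixes a b :: "'a::cstar_algebra_1"
  assumes "nonneg a" "nonneg b"
  shows "nonneg (a + b)"
proof (rule nonnegI)
  show "star (a + b) = a + b" using assms by (simp add: star_add nonneg_sa)
  have "norm ((norm a + norm b) *\<^sub>R 1 - (a + b)) \<le>
      norm (norm a *\<^sub>R 1 - a) + norm (norm b *\<^sub>R 1 - b)"
    using norm_triangle_ineq[of "norm a *\<^sub>R 1 - a" "norm b *\<^sub>R 1 - b"]
    by (simp add: algebra_simps)
  also have "\<dots> \<le> norm a + norm b" by (intro add_mono nonneg_norm_diff_le assms order_refl)
  finally show "norm ((norm a + norm b) *\<^sub>R 1 - (a + b)) \<le> norm a + norm b" .
qed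

lemma nonneg_scaleR: "0 \<le> r \<Longrightarrow> nonneg a \<Longrightarrow> nonneg (r *\<^sub>R a)"
proof -
  assume r: "0 \<le> r" and "nonneg a"
  then obtain s where s: "star s = s" "a = s * s" by (auto simp: nonneg_def)
  have "r *\<^sub>R a = (sqrt r *\<^sub>R s) * (sqrt r *\<^sub>R s)" using r by (simp add: s)
  then show ?thesis using s by (auto simp: nonneg_def star_scaleR intro!: exI[of _ "sqrt r *\<^sub>R s"])
qed

lemma nonneg_one: "nonneg (1 :: 'a::cstar_algebra_1)"
  using nonneg_square[of "1::'a"] by simp

lemma nonneg_zero: "nonneg (0 :: 'a::cstar_algebra_1)"
  using nonneg_square[of "0::'a"] by simp

lemma nonneg_mult:
  fixes a b :: "'a::cstar_algebra_1"
  assumes a: "nonneg a" and b: "nonneg b" and comm: "a * b = b * a"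
  shows "nonneg (a * b)"
proof -
  obtain s where s: "star s = s" "s * s = a" "\<And>z. a * z = z * a \<Longrightarrow> s * z = z * s"
    using nonneg_sqrt[OF a] by metis
  obtain t where t: "star t = t" "t * t = b" "\<And>z. b * z = z * b \<Longrightarrow> t * z = z * t"
    using nonneg_sqrt[OF b] by metis
  have "s * b = b * s" by (rule s(3)[OF comm])
  then have ts: "t * s = s * t" using t(3)[of s] by simp
  have "a * b = (s * t) * (s * t)" by (metis s(2) t(2) ts mult.assoc)
  moreover have "star (s * t) = s * t" by (simp add: star_mult s t ts)
  ultimately show ?thesis by (auto simp: nonneg_def)
qed

lemma nonneg_norm_minus: "star a = a \<Longrightarrow> nonneg (norm a *\<^sub>R 1 - (a :: 'a::cstar_algebra_1))"
  by (rule nonnegI[of _ "norm a"]) (simp_all add: star_diff star_scaleR)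

text \<open>
  The product \<open>(t 1 - a) (t 1 + a) = t\<^sup>2 1 - a\<^sup>2\<close> has a root \<open>y\<close> that commutes with \<open>a\<close>, and
  \<open>norm_le_of_square_sum\<close> applies to \<open>a\<close> and \<open>y\<close>.
\<close>

lemma norm_le_of_nonneg:
  fixes a :: "'a::cstar_algebra_1"
  assumes a: "nonneg a" and b: "nonneg (t *\<^sub>R 1 - a)" and t: "0 \<le> t"
  shows "norm a \<le> t"
proof -
  have "nonneg (t *\<^sub>R 1 + a)" by (intro nonneg_add nonneg_scaleR nonneg_one a t)
  then have "nonneg ((t *\<^sub>R 1 - a) * (t *\<^sub>R 1 + a))"
    by (rule nonneg_mult[OF b]) (simp add: algebra_simps)
  moreover have "(t *\<^sub>R 1 - a) * (t *\<^sub>R 1 + a) = (t * t) *\<^sub>R 1 - a * a"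
    by (simp add: algebra_simps)
  ultimately obtain y where y: "star y = y" "y * y = (t * t) *\<^sub>R 1 - a * a"
    "\<And>z. ((t * t) *\<^sub>R 1 - a * a) * z = z * ((t * t) *\<^sub>R 1 - a * a) \<Longrightarrow> y * z = z * y"
    by (metis nonneg_sqrt)
  have "y * a = a * y" by (rule y(3)) (simp add: algebra_simps)
  then have "(norm a)\<^sup>2 \<le> t * t"
    by (intro norm_le_of_square_sum[OF nonneg_sa[OF a] y(1)]) (simp_all add: y(2))
  then show ?thesis using t by (simp add: power2_eq_square[symmetric] power2_le_iff_abs_le)
qed

lemma nonneg_norm_mono:
  fixes a b :: "'a::cstar_algebra_1"
  assumes "nonneg a" "nonneg (b - a)"
  shows "norm a \<le> norm b"
proof (rule norm_le_of_nonneg[OF assms(1)])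
  have "star b = b" using nonneg_sa[OF nonneg_add[OF assms]] by simp
  then have "nonneg (norm b *\<^sub>R 1 - b)" by (rule nonneg_norm_minus)
  from nonneg_add[OF this assms(2)] show "nonneg (norm b *\<^sub>R 1 - a)" by simp
qed simp

lemma nonneg_antisym:
  fixes a :: "'a::cstar_algebra_1"
  assumes "nonneg a" "nonneg (- a)"
  shows "a = 0"
  using nonneg_norm_mono[of a 0] assms by simp

lemma nonneg_limit:
  fixes a :: "'a::cstar_algebra_1"
  assumes X: "X \<longlonglongrightarrow> a" and pos: "\<And>n. nonneg (X n)"
  shows "nonneg a"
proof (rule nonnegI)
  show "star a = a"
    using LIMSEQ_unique[OF bounded_linear.tendsto[OF bounded_linear_star X]] X
    by (simp add: nonneg_sa[OF pos])
  show "norm (norm a *\<^sub>R 1 - a) \<le> norm a"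
  proof (rule LIMSEQ_le)
    show "(\<lambda>n. norm (norm (X n) *\<^sub>R 1 - X n)) \<longlonglongrightarrow> norm (norm a *\<^sub>R 1 - a)"
      by (intro tendsto_intros X)
    show "(\<lambda>n. norm (X n)) \<longlonglongrightarrow> norm a" by (intro tendsto_intros X)
    show "\<exists>N. \<forall>n\<ge>N. norm (norm (X n) *\<^sub>R 1 - X n) \<le> norm (X n)"
      using nonneg_norm_diff_le[OF pos order_refl] by blast
  qed
qed

section \<open>Invertibility and nonnegativity\<close>

definition has_inverse :: "'a::cstar_algebra_1 \<Rightarrow> bool" where
  "has_inverse a \<longleftrightarrow> (\<exists>b. a * b = 1 \<and> b * a = 1)"

lemma norm_power_le: "norm (h ^ n) \<le> norm (h :: 'a::cstar_algebra_1) ^ n"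
proof (induction n)
  case (Suc n)
  have "norm (h ^ Suc n) \<le> norm h * norm (h ^ n)" by (simp add: norm_mult_ineq)
  also have "\<dots> \<le> norm h * norm h ^ n" by (intro mult_left_mono Suc norm_ge_zero)
  finally show ?case by simp
qed (simp add: norm_one_le)

lemma has_inverse_one_minus:
  fixes h :: "'a::cstar_algebra_1"
  assumes "norm h < 1"
  shows "has_inverse (1 - h)"
proof -
  have sm: "summable (\<lambda>n. h ^ n)"
    by (rule summable_comparison_test'[OF summable_geometric[of "norm h"]])
      (use assms norm_power_le in auto)
  define S where "S = (\<Sum>n. h ^ n)"
  have shift: "(\<Sum>n. h ^ Suc n) = S - 1" using suminf_split_head[OF sm] by (simp add: S_def)
  have "h * S = S - 1" using suminf_mult[OF sm, of h] shift by (simp add: S_def)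
  moreover have "S * h = S - 1"
    using suminf_mult2[OF sm, of h] shift by (simp add: S_def power_commutes)
  ultimately show ?thesis
    unfolding has_inverse_def by (intro exI[of _ S]) (simp add: algebra_simps)
qed

lemma has_inverse_scaleR:
  fixes a :: "'a::cstar_algebra_1"
  assumes "has_inverse a" "r \<noteq> 0"
  shows "has_inverse (r *\<^sub>R a)"
proof -
  obtain b where "a * b = 1" "b * a = 1" using assms by (auto simp: has_inverse_def)
  then show ?thesis using assms(2)
    unfolding has_inverse_def by (intro exI[of _ "inverse r *\<^sub>R b"]) simp
qed

lemma has_inverse_nonneg_add:
  fixes p :: "'a::cstar_algebra_1"
  assumes "nonneg p" "0 < r"
  shows "has_inverse (p + r *\<^sub>R 1)"
proof -
  define t where "t = norm p + r"
  have t: "0 < t" using assms(2) by (simp add: t_def add_nonneg_pos)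
  define h where "h = (1 / t) *\<^sub>R (norm p *\<^sub>R 1 - p)"
  have "norm h \<le> norm p / t"
    using nonneg_norm_diff_le[OF assms(1) order_refl] t by (simp add: h_def divide_right_mono)
  also have "\<dots> < 1" using t assms(2) by (simp add: t_def)
  finally have "has_inverse (t *\<^sub>R (1 - h))"
    using t by (intro has_inverse_scaleR has_inverse_one_minus) auto
  moreover have "t *\<^sub>R (1 - h) = p + r *\<^sub>R 1"
    using t by (simp add: h_def t_def scaleR_diff_right scaleR_add_left)
  ultimately show ?thesis by simp
qed

lemma has_inverse_commuting_factor:
  fixes a b :: "'a::cstar_algebra_1"
  assumes "a * b = b * a" "has_inverse (a * b)"
  shows "has_inverse a"
proof -
  obtain c where c: "a * b * c = 1" "c * (a * b) = 1" using assms(2) by (auto simp: has_inverse_def)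
  have r: "a * (b * c) = 1" using c(1) by (simp add: mult.assoc)
  have l: "(c * b) * a = 1" using c(2) assms(1) by (simp add: mult.assoc)
  have "c * b = b * c" by (metis l r mult.assoc mult_1_left mult_1_right)
  with l r show ?thesis unfolding has_inverse_def by metis
qed

lemma inverse_commute:
  fixes a b z :: "'a::cstar_algebra_1"
  assumes "a * b = 1" "b * a = 1" "a * z = z * a"
  shows "b * z = z * b"
  by (metis assms mult.assoc mult_1_left mult_1_right)

lemma nonneg_inverse:
  fixes a b :: "'a::cstar_algebra_1"
  assumes a: "nonneg a" and b: "a * b = 1" "b * a = 1"
  shows "nonneg b"
proof -
  obtain s where s: "star s = s" "a = s * s" using a by (auto simp: nonneg_def)
  have "star b * a = 1" using b(1) nonneg_sa[OF a] star_mult[of a b] by simp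
  then have sb: "star b = b" by (metis b(1) mult.assoc mult_1_left mult_1_right)
  have c: "b * s = s * b" by (rule inverse_commute[OF b]) (simp add: s mult.assoc)
  have "(b * s) * (b * s) = b" by (metis b(2) c mult.assoc mult_1_right s(2))
  moreover have "star (b * s) = b * s" by (simp add: star_mult sb s(1) c)
  ultimately show ?thesis using nonneg_square[of "b * s"] by simp
qed

text \<open>
  A continuity argument: let \<open>m\<close> be the least \<open>l \<ge> 0\<close> such that \<open>a + l 1\<close>
  is nonnegative. If \<open>m > 0\<close>, then \<open>a + m 1\<close> is nonnegative and has an inverse \<open>c\<close>, so with
  \<open>M > \<parallel>c\<parallel>\<close> the product of \<open>a + m 1\<close> with
  \<open>M 1 - c\<close> is nonnegative; this says that \<open>a + (m - 1/M) 1\<close> is nonnegative, contrary to the choice of \<open>m\<close>.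
\<close>

lemma nonneg_of_resolvent:
  fixes a :: "'a::cstar_algebra_1"
  assumes sa: "star a = a" and inv: "\<And>l. 0 < l \<Longrightarrow> has_inverse (a + l *\<^sub>R 1)"
  shows "nonneg a"
proof -
  define P where "P = {l. 0 \<le> l \<and> nonneg (a + l *\<^sub>R 1)}"
  define m where "m = Inf P"
  have "nonneg (a + norm a *\<^sub>R 1)"
    by (rule nonnegI[of _ "norm a"]) (simp_all add: star_add star_scaleR sa)
  then have ne: "P \<noteq> {}" by (auto simp: P_def intro!: exI[of _ "norm a"])
  have bdd: "bdd_below P" by (rule bdd_belowI[of _ 0]) (simp add: P_def)
  have m0: "0 \<le> m" unfolding m_def using ne by (rule cInf_greatest) (simp add: P_def)
  have up: "nonneg (a + l *\<^sub>R 1)" if l: "m < l" for l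
  proof -
    obtain k where k: "k \<in> P" "k < l" using cInf_lessD[OF ne l[unfolded m_def]] by blast
    then have "nonneg ((a + k *\<^sub>R 1) + (l - k) *\<^sub>R 1)"
      using k by (intro nonneg_add[of _ "(l - k) *\<^sub>R 1"] nonneg_scaleR nonneg_one) (auto simp: P_def)
    then show ?thesis by (simp add: scaleR_diff_left)
  qed
  have pm: "nonneg (a + m *\<^sub>R 1)"
  proof (rule nonneg_limit)
    show "(\<lambda>n. a + (m + inverse (real (Suc n))) *\<^sub>R 1) \<longlonglongrightarrow> a + m *\<^sub>R 1"
      by (intro tendsto_intros LIMSEQ_inverse_real_of_nat_add)
    show "nonneg (a + (m + inverse (real (Suc n))) *\<^sub>R 1)" for n by (rule up) simp
  qed
  show ?thesis
  proof (cases "m = 0")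
    case True
    with pm show ?thesis by simp
  next
    case False
    with m0 have m: "0 < m" by simp
    obtain c where c: "(a + m *\<^sub>R 1) * c = 1" "c * (a + m *\<^sub>R 1) = 1"
      using inv[OF m] by (auto simp: has_inverse_def)
    have nc: "nonneg c" by (rule nonneg_inverse[OF pm c])
    \<comment> \<open>The summand \<open>1\<close> makes \<open>M\<close> positive also in the zero algebra.\<close>
    define M where "M = norm c + 1"
    have M: "0 < M" by (simp add: M_def add_nonneg_pos)
    have "nonneg ((norm c *\<^sub>R 1 - c) + 1)"
      by (intro nonneg_add nonneg_norm_minus nonneg_sa nc nonneg_one)
    then have "nonneg (M *\<^sub>R 1 - c)" by (simp add: M_def algebra_simps)
    then have "nonneg ((a + m *\<^sub>R 1) * (M *\<^sub>R 1 - c))"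
      by (rule nonneg_mult[OF pm]) (simp only: left_diff_distrib right_diff_distrib c, simp)
    then have "nonneg (M *\<^sub>R (a + m *\<^sub>R 1) - 1)"
      by (simp only: right_diff_distrib c) simp
    then have "nonneg ((1/M) *\<^sub>R (M *\<^sub>R (a + m *\<^sub>R 1) - 1))"
      using M by (intro nonneg_scaleR) auto
    then have p: "nonneg (a + m *\<^sub>R 1 - (1/M) *\<^sub>R 1)" using M by (simp add: scaleR_diff_right)
    define k where "k = max 0 (m - 1/M)"
    have "nonneg ((a + m *\<^sub>R 1 - (1/M) *\<^sub>R 1) + (k - (m - 1/M)) *\<^sub>R 1)"
      by (intro nonneg_add p nonneg_scaleR nonneg_one) (simp add: k_def)
    then have "k \<in> P" by (simp add: P_def k_def scaleR_diff_left)
    then have "m \<le> k" unfolding m_def using bdd by (rule cInf_lower)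
    moreover have "k < m" using m M by (simp add: k_def)
    ultimately show ?thesis by simp
  qed
qed

text \<open>
  Apart from \<open>0\<close>, the spectra of \<open>v\<^sup>* v\<close> and \<open>v v\<^sup>*\<close> agree: from the inverse \<open>k\<close> of \<open>l 1 - v\<^sup>* v\<close> one obtains
  \<open>(1 + v k v\<^sup>*) / l\<close> as inverse of \<open>l 1 - v v\<^sup>*\<close>.
\<close>

lemma nonneg_neg_swap:
  fixes v :: "'a::cstar_algebra_1"
  assumes "nonneg (- (star v * v))"
  shows "nonneg (- (v * star v))"
proof (rule nonneg_of_resolvent)
  show "star (- (v * star v)) = - (v * star v)" by (simp add: star_minus star_mult star_star)
  fix l :: real assume l: "0 < l"
  obtain k where k: "(- (star v * v) + l *\<^sub>R 1) * k = 1" "k * (- (star v * v) + l *\<^sub>R 1) = 1"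
    using has_inverse_nonneg_add[OF assms l] by (auto simp: has_inverse_def)
  have k1: "star v * v * k = l *\<^sub>R k - 1" using k(1) by (simp add: algebra_simps)
  have k2: "k * (star v * v) = l *\<^sub>R k - 1" using k(2) by (simp add: algebra_simps)
  have "v * star v * (v * k * star v) = v * (star v * v * k) * star v" by (simp add: mult.assoc)
  then have 1: "v * star v * (v * k * star v) = l *\<^sub>R (v * k * star v) - v * star v"
    unfolding k1 by (simp add: algebra_simps)
  have "v * k * star v * (v * star v) = v * (k * (star v * v)) * star v" by (simp add: mult.assoc)
  then have 2: "v * k * star v * (v * star v) = l *\<^sub>R (v * k * star v) - v * star v"
    unfolding k2 by (simp add: algebra_simps)
  have "has_inverse ((1/l) *\<^sub>R (- (v * star v) + l *\<^sub>R 1))"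
    unfolding has_inverse_def
  proof (intro exI[of _ "1 + v * k * star v"] conjI)
    have "(- (v * star v) + l *\<^sub>R 1) * (1 + v * k * star v) = l *\<^sub>R 1"
      by (simp only: distrib_left distrib_right mult_minus_left 1) simp
    then show "(1/l) *\<^sub>R (- (v * star v) + l *\<^sub>R 1) * (1 + v * k * star v) = 1"
      using l by (simp only: mult_scaleR_left) simp
    have "(1 + v * k * star v) * (- (v * star v) + l *\<^sub>R 1) = l *\<^sub>R 1"
      by (simp only: distrib_left distrib_right mult_minus_right 2) simp
    then show "(1 + v * k * star v) * (1/l) *\<^sub>R (- (v * star v) + l *\<^sub>R 1) = 1"
      using l by (simp only: mult_scaleR_right) simp
  qed
  from has_inverse_scaleR[OF this, of l] l
  show "has_inverse (- (v * star v) + l *\<^sub>R 1)" by simp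
qed

text \<open>Up to a positive factor this is the sum of the squares of the real and the imaginary part of \<open>v\<close>.\<close>

lemma nonneg_star_mult_sum:
  fixes v :: "'a::cstar_algebra_1"
  shows "nonneg (star v * v + v * star v)"
proof -
  define p where "p = v + star v"
  define q where "q = \<i> *\<^sub>C (v - star v)"
  have "star q = q"
    by (simp add: q_def star_scaleC star_diff star_star scaleC_diff_right scaleC_minus_left)
  moreover have "star p = p" by (simp add: p_def star_add star_star add.commute)
  ultimately have "nonneg (p * p + q * q)" by (intro nonneg_add nonneg_square)
  then have "nonneg ((1/2) *\<^sub>R (p * p + q * q))" by (intro nonneg_scaleR) auto
  moreover have "p * p + q * q = 2 *\<^sub>R (star v * v + v * star v)"
    unfolding q_def scaleC_ii_mult by (simp add: p_def algebra_simps scaleR_2)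
  ultimately show ?thesis by simp
qed

lemma sa_cube_zero:
  fixes b :: "'a::cstar_algebra"
  assumes "star b = b" "b * b * b = 0"
  shows "b = 0"
proof -
  have "(b * b) * (b * b) = 0" using assms(2) by (simp add: mult.assoc[symmetric])
  moreover have "star (b * b) = b * b" by (simp add: star_mult assms)
  ultimately have "b * b = 0" using norm_sa_square[of "b * b"] by simp
  then show ?thesis using norm_sa_square[OF assms(1)] by simp
qed

text \<open>
  Let \<open>c = w\<^sup>* w\<close>, \<open>d = \<bar>c\<bar>\<close> and \<open>b = d - c\<close>, twice the negative part of \<open>c\<close>. For \<open>v = w b\<close> one finds
  \<open>v\<^sup>* v = b c b = - d b\<^sup>2\<close>, so \<open>- v\<^sup>* v\<close> and hence \<open>- v v\<^sup>*\<close> are nonnegative. As \<open>v\<^sup>* v + v v\<^sup>*\<close> is nonnegative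
  too, \<open>v\<^sup>* v\<close> and its negative are both nonnegative and \<open>d b\<^sup>2 = 0\<close>. But \<open>b\<^sup>2 = 2 d b\<close>, so \<open>b\<^sup>3 = 0\<close> and \<open>b = 0\<close>.
\<close>

theorem nonneg_star_mult:
  fixes w :: "'a::cstar_algebra_1"
  shows "nonneg (star w * w)"
proof -
  define c where "c = star w * w"
  have sc: "star c = c" by (simp add: c_def star_mult star_star)
  obtain d where d: "nonneg d" "star d = d" "d * d = c * c" "\<And>z. c * c * z = z * (c * c) \<Longrightarrow> d * z = z * d"
    using nonneg_sqrt[OF nonneg_square[OF sc]] by metis
  define b where "b = d - c"
  have dc: "d * c = c * d" by (rule d(4)) (simp add: mult.assoc)
  have sb: "star b = b" by (simp add: b_def star_diff sc d)
  have bc: "b * c = c * b" and bd: "b * d = d * b" by (simp_all add: b_def algebra_simps dc)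
  have cb: "c * b = - (d * b)" by (simp add: b_def algebra_simps d dc)
  define v where "v = w * b"
  have "star v * v = b * c * b" by (simp add: v_def c_def star_mult sb mult.assoc)
  also have "\<dots> = - (d * (b * b))" by (simp add: bc cb mult.assoc[symmetric])
  finally have vv: "star v * v = - (d * (b * b))" .
  have "nonneg (d * (b * b))"
    by (rule nonneg_mult[OF d(1) nonneg_square[OF sb]]) (metis bd mult.assoc)
  then have neg: "nonneg (- (star v * v))" by (simp add: vv)
  have "nonneg ((star v * v + v * star v) + - (v * star v))"
    by (intro nonneg_add nonneg_star_mult_sum nonneg_neg_swap neg)
  then have "nonneg (star v * v)" by simp
  from nonneg_antisym[OF this neg] have dbb: "d * (b * b) = 0" by (simp add: vv)
  have "b * b = d * b - c * b" by (simp add: b_def left_diff_distrib)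
  also have "\<dots> = d * b + d * b" by (simp add: cb)
  finally have "b * b * b = (d * b + d * b) * b" by simp
  also have "\<dots> = 0" using dbb by (simp add: distrib_right mult.assoc)
  finally have "b = 0" by (rule sa_cube_zero[OF sb])
  then show ?thesis using d(1) by (simp add: b_def c_def)
qed

lemma nonneg_conj:
  fixes p w :: "'a::cstar_algebra_1"
  assumes "nonneg p"
  shows "nonneg (star w * p * w)"
proof -
  obtain s where "star s = s" "p = s * s" using assms by (auto simp: nonneg_def)
  then show ?thesis using nonneg_star_mult[of "s * w"] by (simp add: star_mult mult.assoc)
qed

text \<open>
  For \<open>z = \<alpha> + \<i> r\<close> with \<open>r \<noteq> 0\<close> multiply by the conjugate factor:
  \<open>(a - z 1) (a - cnj z 1) = (a - \<alpha> 1)\<^sup>2 + r\<^sup>2 1\<close>.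
\<close>

lemma has_inverse_minus_scaleC:
  fixes a :: "'a::cstar_algebra_1"
  assumes a: "nonneg a" and z: "z \<notin> complex_of_real ` {0..}"
  shows "has_inverse (a - z *\<^sub>C 1)"
proof (cases "Im z = 0")
  case True
  then have zr: "z = complex_of_real (Re z)" by (simp add: complex_eq_iff)
  with z have "Re z < 0" by (metis atLeast_iff imageI not_less)
  moreover have "a - z *\<^sub>C 1 = a + (- Re z) *\<^sub>R 1"
    using scaleC_of_real[of "Re z" "1::'a"] zr by simp
  ultimately show ?thesis using has_inverse_nonneg_add[OF a, of "- Re z"] by simp
next
  case False
  define s where "s = a - Re z *\<^sub>R 1"
  define r where "r = Im z"
  have ss: "star s = s" by (simp add: s_def star_diff star_scaleR nonneg_sa[OF a])
  have iz: "z *\<^sub>C x = Re z *\<^sub>R x + r *\<^sub>R (\<i> *\<^sub>C x)" for x :: 'a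
  proof -
    have "z = complex_of_real (Re z) + complex_of_real r * \<i>"
      by (simp add: r_def complex_eq_iff)
    then have "z *\<^sub>C x = (complex_of_real (Re z) + complex_of_real r * \<i>) *\<^sub>C x" by simp
    then show ?thesis by (simp only: scaleC_add_left scaleC_of_real scaleC_scaleC[symmetric])
  qed
  define i where "i = \<i> *\<^sub>C (1::'a)"
  have ii: "i * i = - 1" by (simp add: i_def scaleC_ii_mult)
  have is0: "i * s = s * i" by (simp add: i_def mult_scaleC_left mult_scaleC_right)
  have "a - z *\<^sub>C 1 = s - r *\<^sub>R i" by (simp add: iz s_def i_def)
  moreover have "has_inverse (s - r *\<^sub>R i)"
  proof (rule has_inverse_commuting_factor)
    have eq: "(s - r *\<^sub>R i) * (s + r *\<^sub>R i) = s * s + (r * r) *\<^sub>R 1"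
      by (simp add: algebra_simps is0 ii)
    have eq': "(s + r *\<^sub>R i) * (s - r *\<^sub>R i) = s * s + (r * r) *\<^sub>R 1"
      by (simp add: algebra_simps is0 ii)
    have "0 < r * r" using False unfolding r_def by (metis not_real_square_gt_zero)
    from has_inverse_nonneg_add[OF nonneg_square[OF ss] this]
    show "has_inverse ((s - r *\<^sub>R i) * (s + r *\<^sub>R i))" by (simp only: eq)
    show "(s - r *\<^sub>R i) * (s + r *\<^sub>R i) = (s + r *\<^sub>R i) * (s - r *\<^sub>R i)"
      by (simp only: eq eq')
  qed
  ultimately show ?thesis by simp
qed

text \<open>
  Positivity in the sense of the spectrum passes through *-homomorphisms into unital algebras, because an
  inverse \<open>(x, \<alpha>)\<close> in the unitization becomes the inverse \<open>\<phi> x + \<alpha> 1\<close>. It is applied to the embedding into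
  the multiplier algebra and to the identity.
\<close>

lemma nonneg_image_of_positive:
  fixes \<phi> :: "'a::cstar_algebra \<Rightarrow> 'b::cstar_algebra_1"
  assumes add: "\<And>x y. \<phi> (x + y) = \<phi> x + \<phi> y"
    and mult: "\<And>x y. \<phi> (x * y) = \<phi> x * \<phi> y"
    and scale: "\<And>c x. \<phi> (c *\<^sub>C x) = c *\<^sub>C \<phi> x"
    and star: "\<And>x. \<phi> (star x) = star (\<phi> x)"
    and pos: "positive_element a"
  shows "nonneg (\<phi> a)"
proof (rule nonneg_of_resolvent)
  have sa: "star a = a" and sp: "spectrum a \<subseteq> complex_of_real ` {0..}"
    using pos by (auto simp: positive_element_def selfadjoint_def)
  show "star (\<phi> a) = \<phi> a" using star[of a] sa by simp
  fix l :: real assume l: "0 < l"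
  have "complex_of_real (- l) \<notin> spectrum a"
  proof
    assume "complex_of_real (- l) \<in> spectrum a"
    with sp obtain r where "complex_of_real (- l) = complex_of_real r" "0 \<le> r" by auto
    with l show False by (metis of_real_eq_iff neg_0_le_iff_le not_less)
  qed
  then obtain x \<alpha> where u: "unitization_mult (a, complex_of_real l) (x, \<alpha>) = (0, 1)"
      "unitization_mult (x, \<alpha>) (a, complex_of_real l) = (0, 1)"
    by (auto simp: spectrum_def)
  define L where "L = complex_of_real l"
  have e: "a * x + L *\<^sub>C x + \<alpha> *\<^sub>C a = 0" "x * a + \<alpha> *\<^sub>C a + L *\<^sub>C x = 0" and la: "L * \<alpha> = 1"
    using u by (simp_all add: unitization_mult_def L_def)
  have \<phi>0: "\<phi> 0 = 0" using add[of 0 0] by simp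
  have e': "\<phi> a * \<phi> x + L *\<^sub>C \<phi> x + \<alpha> *\<^sub>C \<phi> a = 0" "\<phi> x * \<phi> a + \<alpha> *\<^sub>C \<phi> a + L *\<^sub>C \<phi> x = 0"
    using arg_cong[OF e(1), of \<phi>] arg_cong[OF e(2), of \<phi>] by (simp_all add: add mult scale \<phi>0)
  have L1: "l *\<^sub>R 1 = L *\<^sub>C (1::'b)" by (simp add: L_def scaleC_of_real)
  show "has_inverse (\<phi> a + l *\<^sub>R 1)"
    unfolding has_inverse_def L1
  proof (intro exI[of _ "\<phi> x + \<alpha> *\<^sub>C 1"] conjI)
    have "(\<phi> a + L *\<^sub>C 1) * (\<phi> x + \<alpha> *\<^sub>C 1) = (\<phi> a * \<phi> x + L *\<^sub>C \<phi> x + \<alpha> *\<^sub>C \<phi> a) + (L * \<alpha>) *\<^sub>C 1"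
      by (simp add: algebra_simps mult_scaleC_left mult_scaleC_right scaleC_scaleC scaleC_add_right)
    then show "(\<phi> a + L *\<^sub>C 1) * (\<phi> x + \<alpha> *\<^sub>C 1) = 1" by (simp only: e' la) simp
    have "(\<phi> x + \<alpha> *\<^sub>C 1) * (\<phi> a + L *\<^sub>C 1) = (\<phi> x * \<phi> a + \<alpha> *\<^sub>C \<phi> a + L *\<^sub>C \<phi> x) + (L * \<alpha>) *\<^sub>C 1"
      by (simp add: algebra_simps mult_scaleC_left mult_scaleC_right scaleC_scaleC scaleC_add_right)
    then show "(\<phi> x + \<alpha> *\<^sub>C 1) * (\<phi> a + L *\<^sub>C 1) = 1" by (simp only: e' la) simp
  qed
qed

section \<open>The algebra inside its multiplier algebra\<close>

instantiation multiplier :: (cstar_algebra) cstar_algebra_1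
begin

definition one_multiplier :: "'a multiplier" where
  "1 = Abs_multiplier (id_blinfun, id_blinfun)"

lemma lmul_one [simp]: "lmul (1 :: 'a multiplier) = id_blinfun"
  and rmul_one [simp]: "rmul (1 :: 'a multiplier) = id_blinfun"
proof -
  have "double_centralizer (id_blinfun :: 'a \<Rightarrow>\<^sub>L 'a) id_blinfun"
    by (simp add: double_centralizer_def)
  then show "lmul (1 :: 'a multiplier) = id_blinfun" "rmul (1 :: 'a multiplier) = id_blinfun"
    unfolding one_multiplier_def by (rule lmul_Abs rmul_Abs)+
qed

instance
  by standard (rule multiplier_eqI; simp)+

end

lemma canonical_add: "canonical (a + b) = canonical a + canonical b"
  and canonical_diff: "canonical (a - b) = canonical a - canonical b"
  and canonical_mult: "canonical (a * b) = canonical a * canonical b"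
  and canonical_scaleC: "canonical (c *\<^sub>C a) = c *\<^sub>C canonical a"
  and canonical_scaleR: "canonical (r *\<^sub>R a) = r *\<^sub>R canonical a"
  and canonical_star: "canonical (star a) = star (canonical a)"
  and canonical_zero: "canonical 0 = (0 :: 'a multiplier)"
  for a b :: "'a::cstar_algebra"
  by (rule multiplier_eqI; simp add: blinfun.add_left blinfun.diff_left blinfun.scaleR_left
      algebra_simps mult_scaleC_left mult_scaleC_right star_mult star_star)+

lemma multiplier_times_canonical: "X * canonical a = canonical (lmul X a)"
  and canonical_times_multiplier: "canonical a * X = canonical (rmul X a)"
  by (rule multiplier_eqI; simp add: lmul_mult rmul_mult rmul_lmul)+

lemma canonical_inject: "canonical a = canonical b \<longleftrightarrow> a = b"
proof
  assume "canonical a = canonical b"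
  then have "rmul (canonical a) c = rmul (canonical b) c" for c by simp
  then show "a = b" by (intro mult_left_eqI[of a b]) simp
qed simp

lemma norm_canonical: "norm (canonical a) = norm a"
proof (rule antisym)
  show "norm (canonical a) \<le> norm a"
    unfolding norm_multiplier_def by (rule norm_blinfun_bound) (simp_all add: norm_mult_ineq)
  have "norm (b * a) \<le> norm (canonical a) * norm b" for b
    using norm_blinfun[of "rmul (canonical a)" b] by (simp add: norm_multiplier_def norm_rmul)
  then show "norm a \<le> norm (canonical a)" by (rule norm_le_of_left_mult[rotated]) simp
qed

text \<open>
  Conversely, let \<open>k\<close> be the inverse of \<open>a - z 1\<close> in the multiplier algebra, \<open>z \<noteq> 0\<close>. Then
  \<open>k = (a k - 1) / z\<close> has the form \<open>x - 1/z\<close> with \<open>x = a k / z\<close> in the algebra, so it comes from the unitization.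
\<close>

lemma positive_element_iff_nonneg: "positive_element a \<longleftrightarrow> nonneg (canonical a)"
proof
  show "nonneg (canonical a)" if "positive_element a"
    by (rule nonneg_image_of_positive[OF canonical_add canonical_mult canonical_scaleC
          canonical_star that])
  assume a: "nonneg (canonical a)"
  have "star a = a" using nonneg_sa[OF a] by (simp add: canonical_star[symmetric] canonical_inject)
  moreover have "z \<in> complex_of_real ` {0..}" if "z \<in> spectrum a" for z
  proof (rule ccontr)
    assume nz: "z \<notin> complex_of_real ` {0..}"
    then have z: "z \<noteq> 0" by (metis atLeast_iff imageI of_real_0 order_refl)
    obtain k where k: "(canonical a - z *\<^sub>C 1) * k = 1" "k * (canonical a - z *\<^sub>C 1) = 1"
      using has_inverse_minus_scaleC[OF a nz] by (auto simp: has_inverse_def)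
    have zk: "z *\<^sub>C k = canonical a * k - 1" "z *\<^sub>C k = k * canonical a - 1"
    proof -
      have sub: "y = x - w" if "x - y = w" for x y w :: "'a multiplier"
        using that by auto
      have "canonical a * k - z *\<^sub>C k = 1"
        using k(1) by (simp add: left_diff_distrib mult_scaleC_left)
      then show "z *\<^sub>C k = canonical a * k - 1" by (rule sub)
      have "k * canonical a - z *\<^sub>C k = 1"
        using k(2) by (simp add: right_diff_distrib mult_scaleC_right)
      then show "z *\<^sub>C k = k * canonical a - 1" by (rule sub)
    qed
    define x where "x = (1/z) *\<^sub>C rmul k a"
    have cx: "canonical x = k + (1/z) *\<^sub>C 1"
    proof -
      have "canonical x = (1/z) *\<^sub>C (z *\<^sub>C k + 1)"
        by (simp add: x_def canonical_scaleC canonical_times_multiplier[symmetric] zk(1))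
      then show ?thesis using z by (simp add: scaleC_add_right scaleC_scaleC)
    qed
    have "canonical (a * x + (- z) *\<^sub>C x + (- 1/z) *\<^sub>C a) = 0"
    proof -
      have "canonical (a * x + (- z) *\<^sub>C x + (- 1/z) *\<^sub>C a) = (canonical a * k - z *\<^sub>C k - 1)"
        using z by (simp add: canonical_add canonical_diff canonical_mult canonical_scaleC cx distrib_left
          scaleC_add_right scaleC_scaleC scaleC_minus_left mult_scaleC_right)
      then show ?thesis by (simp add: zk(1))
    qed
    then have 1: "a * x + (- z) *\<^sub>C x + (- 1/z) *\<^sub>C a = 0"
      by (metis canonical_inject canonical_zero)
    have "canonical (x * a + (- 1/z) *\<^sub>C a + (- z) *\<^sub>C x) = 0"
    proof -
      have "canonical (x * a + (- 1/z) *\<^sub>C a + (- z) *\<^sub>C x) = (k * canonical a - z *\<^sub>C k - 1)"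
        using z by (simp add: canonical_add canonical_diff canonical_mult canonical_scaleC cx distrib_right
          scaleC_add_right scaleC_scaleC scaleC_minus_left mult_scaleC_left)
      then show ?thesis by (simp add: zk(2))
    qed
    then have 2: "x * a + (- 1/z) *\<^sub>C a + (- z) *\<^sub>C x = 0"
      by (metis canonical_inject canonical_zero)
    have "unitization_mult (a, - z) (x, - 1/z) = (0, 1)" "unitization_mult (x, - 1/z) (a, - z) = (0, 1)"
      using 1 2 z by (simp_all add: unitization_mult_def)
    then have "z \<notin> spectrum a" unfolding spectrum_def by blast
    with that show False by blast
  qed
  ultimately show "positive_element a" by (auto simp: positive_element_def selfadjoint_def)
qed

lemma nonneg_of_positive_element:
  fixes T :: "'a::cstar_algebra_1"
  shows "positive_element T \<Longrightarrow> nonneg T"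
  by (rule nonneg_image_of_positive[of "\<lambda>x. x"]) simp_all

section \<open>Positive and negative parts\<close>

text \<open>
  Here \<open>d\<close> plays the role of \<open>\<bar>x\<bar>\<close>. Put \<open>c = d + x\<close>, \<open>e = \<bar>c\<bar>\<close>, \<open>b = e - c\<close>, so that \<open>c b = - e b\<close>. From
  \<open>c\<^sup>2 = 2 d c\<close> it follows that the square \<open>(c b)\<^sup>2\<close> equals \<open>- 2 d e b\<^sup>2\<close>, which is the negative of a nonnegative element. Hence
  \<open>c b = 0\<close>, then \<open>b = 0\<close>, that is \<open>c = \<bar>c\<bar>\<close>.
\<close>

lemma nonneg_abs_add:
  fixes d x :: "'a::cstar_algebra_1"
  assumes d: "nonneg d" "d * d = x * x" "d * x = x * d" and sx: "star x = x"
  shows "nonneg (d + x)"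
proof -
  define c where "c = d + x"
  have sc: "star c = c" by (simp add: c_def star_add nonneg_sa d sx)
  obtain e where e: "nonneg e" "star e = e" "e * e = c * c" "\<And>z. c * c * z = z * (c * c) \<Longrightarrow> e * z = z * e"
    using nonneg_sqrt[OF nonneg_square[OF sc]] by metis
  have dc: "d * c = c * d" by (simp add: c_def algebra_simps d)
  have ec: "e * c = c * e" by (rule e(4)) (simp add: mult.assoc)
  have ed: "e * d = d * e" by (rule e(4)) (metis dc mult.assoc)
  define b where "b = e - c"
  have sb: "star b = b" by (simp add: b_def star_diff sc e)
  have cb: "c * b = - (e * b)" by (simp add: b_def algebra_simps e ec)
  have bc: "b * c = c * b" and bd: "b * d = d * b" and be: "b * e = e * b"
    by (simp_all add: b_def algebra_simps ec ed dc)
  have "c * c = d * c + d * c" by (simp add: c_def algebra_simps d)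
  then have cc: "c * c = 2 *\<^sub>R (d * c)" by (simp add: scaleR_2)
  have "star (c * b) = c * b" by (simp add: star_mult sb sc bc)
  then have p1: "nonneg ((c * b) * (c * b))" by (rule nonneg_square)
  have "(c * b) * (c * b) = c * c * (b * b)" by (metis bc mult.assoc)
  also have "\<dots> = 2 *\<^sub>R (d * (c * b) * b)" by (simp only: cc mult_scaleR_left) (simp add: mult.assoc)
  also have "\<dots> = - (2 *\<^sub>R (d * e * (b * b)))" by (simp only: cb) (simp add: mult.assoc)
  finally have eq: "(c * b) * (c * b) = - (2 *\<^sub>R (d * e * (b * b)))" .
  have "nonneg (d * e)" by (rule nonneg_mult[OF d(1) e(1) ed[symmetric]])
  then have "nonneg (d * e * (b * b))"
    by (rule nonneg_mult[OF _ nonneg_square[OF sb]]) (metis bd be mult.assoc)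
  then have "nonneg (- ((c * b) * (c * b)))" unfolding eq by (simp add: nonneg_scaleR)
  from nonneg_antisym[OF p1 this] have "c * b = 0"
    using norm_sa_square[OF \<open>star (c * b) = c * b\<close>] by simp
  then have "b * b = 0" using cb by (simp add: b_def left_diff_distrib)
  then have "b = 0" using norm_sa_square[OF sb] by simp
  then show ?thesis using e(1) by (simp add: b_def c_def)
qed

text \<open>
  The commutation clause selects a root of \<open>x\<^sup>2\<close> in the bicommutant of \<open>x\<close>, so that positive and negative
  parts commute with each other and with \<open>x\<close>.
\<close>

definition abs_val :: "'a::cstar_algebra_1 \<Rightarrow> 'a" where
  "abs_val x = (SOME d. nonneg d \<and> d * d = x * x \<and> (\<forall>z. x * z = z * x \<longrightarrow> d * z = z * d))"

definition pos_part :: "'a::cstar_algebra_1 \<Rightarrow> 'a" where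
  "pos_part x = (1/2) *\<^sub>R (abs_val x + x)"

definition neg_part :: "'a::cstar_algebra_1 \<Rightarrow> 'a" where
  "neg_part x = (1/2) *\<^sub>R (abs_val x - x)"

lemma
  fixes x :: "'a::cstar_algebra_1"
  assumes sx: "star x = x"
  shows nonneg_abs_val: "nonneg (abs_val x)"
    and abs_val_square: "abs_val x * abs_val x = x * x"
    and abs_val_commute: "x * z = z * x \<Longrightarrow> abs_val x * z = z * abs_val x"
proof -
  obtain d where d: "nonneg d" "d * d = x * x" "\<And>z. x * x * z = z * (x * x) \<Longrightarrow> d * z = z * d"
    using nonneg_sqrt[OF nonneg_square[OF sx]] by metis
  have "d * z = z * d" if "x * z = z * x" for z
    by (rule d(3)) (metis that mult.assoc)
  with d have "nonneg d \<and> d * d = x * x \<and> (\<forall>z. x * z = z * x \<longrightarrow> d * z = z * d)" by blast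
  then have "nonneg (abs_val x) \<and> abs_val x * abs_val x = x * x \<and>
      (\<forall>z. x * z = z * x \<longrightarrow> abs_val x * z = z * abs_val x)"
    unfolding abs_val_def by (rule someI)
  then show "nonneg (abs_val x)" "abs_val x * abs_val x = x * x"
    "x * z = z * x \<Longrightarrow> abs_val x * z = z * abs_val x" by blast+
qed

lemma
  fixes x :: "'a::cstar_algebra_1"
  assumes sx: "star x = x"
  shows nonneg_pos_part: "nonneg (pos_part x)"
    and nonneg_neg_part: "nonneg (neg_part x)"
    and pos_part_minus_neg_part: "pos_part x - neg_part x = x"
    and neg_part_mult_pos_part: "neg_part x * pos_part x = 0"
    and pos_part_commute: "x * z = z * x \<Longrightarrow> pos_part x * z = z * pos_part x"
    and neg_part_commute: "x * z = z * x \<Longrightarrow> neg_part x * z = z * neg_part x"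
proof -
  note a = nonneg_abs_val[OF sx] abs_val_square[OF sx] abs_val_commute[OF sx]
  have ax: "abs_val x * x = x * abs_val x" by (rule a(3)) simp
  show "nonneg (pos_part x)"
    unfolding pos_part_def by (intro nonneg_scaleR nonneg_abs_add a ax sx) simp
  have "nonneg (abs_val x + - x)"
    by (rule nonneg_abs_add) (simp_all add: a ax star_minus sx)
  then show "nonneg (neg_part x)" by (simp add: neg_part_def nonneg_scaleR)
  show "pos_part x - neg_part x = x"
    by (simp add: pos_part_def neg_part_def algebra_simps flip: scaleR_add_left)
  show "neg_part x * pos_part x = 0"
    by (simp add: pos_part_def neg_part_def algebra_simps a(2) ax)
  show "pos_part x * z = z * pos_part x" "neg_part x * z = z * neg_part x" if "x * z = z * x"
    using a(3)[OF that] that by (simp_all add: pos_part_def neg_part_def algebra_simps)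
qed

section \<open>Approximate identities that absorb their predecessors\<close>

text \<open>
  The functions \<open>(h - r)\<^sub>+\<close> and \<open>(h - 2 r)\<^sub>-\<close> have no common zero; their sum is at least
  \<open>(h - r) - (h - 2 r) = r\<close>, so it is invertible. Its inverse \<open>u\<close> turns the two into a partition of unity.
\<close>

lemma cutoff_factor:
  fixes h :: "'a::cstar_algebra_1"
  assumes sh: "star h = h" and r: "0 < r"
  obtains u where "nonneg u" "\<And>z. h * z = z * h \<Longrightarrow> u * z = z * u"
    "pos_part (h - r *\<^sub>R 1) * u + neg_part (h - (2 * r) *\<^sub>R 1) * u = 1"
proof -
  define x where "x = h - r *\<^sub>R 1"
  define y where "y = h - (2 * r) *\<^sub>R 1"
  have sx: "star x = x" and sy: "star y = y" by (simp_all add: x_def y_def star_diff star_scaleR sh)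
  define k where "k = pos_part x + neg_part y"
  have "k = (neg_part x + pos_part y) + r *\<^sub>R 1"
  proof -
    have "pos_part x = x + neg_part x" "neg_part y = pos_part y - y"
      using pos_part_minus_neg_part[OF sx] pos_part_minus_neg_part[OF sy] by (simp_all add: algebra_simps)
    then have "k = (neg_part x + pos_part y) + (x - y)" by (simp add: k_def)
    also have "x - y = r *\<^sub>R 1" by (simp add: x_def y_def flip: scaleR_diff_left)
    finally show ?thesis .
  qed
  moreover have "nonneg (neg_part x + pos_part y)"
    by (intro nonneg_add nonneg_pos_part nonneg_neg_part sx sy)
  ultimately have "has_inverse k" using has_inverse_nonneg_add r by metis
  then obtain u where u: "k * u = 1" "u * k = 1" by (auto simp: has_inverse_def)
  have "nonneg k" unfolding k_def by (intro nonneg_add nonneg_pos_part nonneg_neg_part sx sy)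
  then have "nonneg u" using u by (rule nonneg_inverse)
  moreover have "u * z = z * u" if "h * z = z * h" for z
  proof (rule inverse_commute[OF u])
    have "x * z = z * x" "y * z = z * y" using that by (simp_all add: x_def y_def algebra_simps)
    then show "k * z = z * k"
      by (simp add: k_def pos_part_commute[OF sx] neg_part_commute[OF sy] algebra_simps)
  qed
  ultimately show ?thesis
    using that u(1) by (simp add: k_def x_def y_def distrib_right)
qed

lemma commute_mult:
  fixes a b z :: "'a::semigroup_mult"
  assumes "a * z = z * a" "b * z = z * b"
  shows "a * b * z = z * (a * b)"
  by (metis assms mult.assoc)

text \<open>
  With \<open>r = (1/2)\<^sup>n\<close> the element \<open>f n = (h - r)\<^sub>+ u\<close> is a cutoff of \<open>h\<close>: as a function of \<open>h\<close> it vanishes up to \<open>r\<close>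
  and is \<open>1\<close> from \<open>2 r\<close> on. Since \<open>1 - f (n+1)\<close> has the factor \<open>(h - r)\<^sub>-\<close> for the same \<open>r\<close>, it is annihilated
  by \<open>f n\<close>. Monotonicity follows from \<open>f (n+1) - f n = f (n+1) (1 - f n)\<close>. The norm bound holds because
  \<open>1 - f n\<close> is supported where \<open>h \<le> 2 r\<close>. The explicit formula for \<open>f\<close> is kept in order to place
  \<open>f\<close> in the ideal that contains \<open>h\<close>.
\<close>

lemma cutoff_sequence:
  fixes h :: "'a::cstar_algebra_1"
  assumes h: "nonneg h"
  obtains f u where "\<And>n. f n = pos_part (h - (1/2)^n *\<^sub>R 1) * u n"
    "\<And>n. nonneg (f n)" "\<And>n. nonneg (1 - f n)" "\<And>n. nonneg (f (Suc n) - f n)"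
    "\<And>n. f (Suc n) * f n = f n" "\<And>n. norm ((1 - f n) * h) \<le> 2 * (1/2)^n"
proof -
  have sh: "star h = h" by (rule nonneg_sa[OF h])
  define p where "p n = pos_part (h - (1/2)^n *\<^sub>R 1)" for n :: nat
  define q where "q n = neg_part (h - (2 * (1/2)^n) *\<^sub>R 1)" for n :: nat
  have "\<exists>u. nonneg u \<and> (\<forall>z. h * z = z * h \<longrightarrow> u * z = z * u) \<and> p n * u + q n * u = 1" for n
  proof -
    have "0 < (1/2 :: real)^n" by simp
    from cutoff_factor[OF sh this] show ?thesis unfolding p_def q_def by blast
  qed
  then obtain u where u: "\<And>n. nonneg (u n)" "\<And>n z. h * z = z * h \<Longrightarrow> u n * z = z * u n"
    "\<And>n. p n * u n + q n * u n = 1" by metis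
  have sx: "star (h - r *\<^sub>R 1) = h - r *\<^sub>R 1" for r by (simp add: star_diff star_scaleR sh)
  have hx: "(h - r *\<^sub>R 1) * z = z * (h - r *\<^sub>R 1)" if "h * z = z * h" for r z
    using that by (simp add: algebra_simps)
  have pz: "p n * z = z * p n" and qz: "q n * z = z * q n" if "h * z = z * h" for n z
    unfolding p_def q_def using that by (intro pos_part_commute neg_part_commute sx hx; simp)+
  have hu: "h * u n = u n * h" and hp: "h * p n = p n * h" for n
    using u(2)[of h n] pz[of h n] by simp_all
  have np: "nonneg (p n)" and nq: "nonneg (q n)" for n
    unfolding p_def q_def by (intro nonneg_pos_part nonneg_neg_part sx)+
  define f where "f n = p n * u n" for n
  have g: "1 - f n = q n * u n" for n using u(3)[of n] by (simp add: f_def algebra_simps)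
  have nf: "nonneg (f n)" for n unfolding f_def by (rule nonneg_mult[OF np u(1) pz[OF hu]])
  have ng: "nonneg (1 - f n)" for n unfolding g by (rule nonneg_mult[OF nq u(1) qz[OF hu]])
  have hf: "h * f n = f n * h" for n unfolding f_def by (rule commute_mult[symmetric]) (simp_all add: hp hu)
  have fz: "f n * z = z * f n" if "h * z = z * h" for n z
    unfolding f_def by (rule commute_mult[OF pz[OF that] u(2)[OF that]])
  have ff: "f (Suc n) * f n = f n" for n
  proof -
    have "q (Suc n) * p n = 0"
      unfolding p_def q_def using neg_part_mult_pos_part[OF sx, of "(1/2)^n"] by simp
    moreover have "(1 - f (Suc n)) * f n = u (Suc n) * (q (Suc n) * p n) * u n"
      unfolding g unfolding f_def by (simp add: mult.assoc qz[OF hu])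
    ultimately have "(1 - f (Suc n)) * f n = 0" by simp
    then show ?thesis by (simp add: left_diff_distrib)
  qed
  have inc: "nonneg (f (Suc n) - f n)" for n
  proof -
    have "nonneg (f (Suc n) * (1 - f n))"
      by (rule nonneg_mult[OF nf ng]) (simp add: algebra_simps fz[OF hf])
    then show ?thesis by (simp add: right_diff_distrib ff)
  qed
  have "norm ((1 - f n) * h) \<le> 2 * (1/2)^n" for n
  proof (rule norm_le_of_nonneg)
    let ?r = "2 * (1/2)^n :: real" and ?y = "h - (2 * (1/2)^n) *\<^sub>R 1"
    show "nonneg ((1 - f n) * h)" by (rule nonneg_mult[OF ng h]) (simp add: algebra_simps hf)
    have "h = ?r *\<^sub>R 1 + (pos_part ?y - neg_part ?y)"
      using pos_part_minus_neg_part[OF sx, of ?r] by simp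
    then have "q n * h = ?r *\<^sub>R q n + (neg_part ?y * pos_part ?y - neg_part ?y * neg_part ?y)"
    proof -
      assume *: "h = ?r *\<^sub>R 1 + (pos_part ?y - neg_part ?y)"
      have "q n * (?r *\<^sub>R 1 + (pos_part ?y - neg_part ?y)) =
          ?r *\<^sub>R q n + (neg_part ?y * pos_part ?y - neg_part ?y * neg_part ?y)"
        by (simp add: q_def distrib_left right_diff_distrib)
      then show ?thesis by (simp only: *[symmetric])
    qed
    then have qh: "q n * h = ?r *\<^sub>R q n - q n * q n"
      using neg_part_mult_pos_part[OF sx, of ?r] by (simp add: q_def)
    have "(1 - f n) * h = u n * (q n * h)" unfolding g by (simp add: mult.assoc qz[OF hu])
    also have "\<dots> = ?r *\<^sub>R (1 - f n) - u n * (q n * q n)"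
      unfolding qh g by (simp add: right_diff_distrib qz[OF hu])
    finally have "?r *\<^sub>R 1 - (1 - f n) * h = ?r *\<^sub>R f n + u n * (q n * q n)"
      by (simp add: algebra_simps)
    moreover have "nonneg (u n * (q n * q n))"
      by (rule nonneg_mult[OF u(1) nonneg_square[OF nonneg_sa[OF nq]]])
        (rule commute_mult[OF qz[OF hu] qz[OF hu], symmetric])
    ultimately show "nonneg (?r *\<^sub>R 1 - (1 - f n) * h)"
      by (simp add: nonneg_add nonneg_scaleR nf)
  qed simp
  then show ?thesis
    by (intro that[of f u] nf ng inc ff) (simp_all add: f_def p_def)
qed

lemma
  shows range_canonical_left: "x \<in> range canonical \<Longrightarrow> x * X \<in> range canonical"
    and range_canonical_add: "x \<in> range canonical \<Longrightarrow> y \<in> range canonical \<Longrightarrow> x + y \<in> range canonical"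
    and range_canonical_diff: "x \<in> range canonical \<Longrightarrow> y \<in> range canonical \<Longrightarrow> x - y \<in> range canonical"
    and range_canonical_scaleR: "x \<in> range canonical \<Longrightarrow> r *\<^sub>R x \<in> range canonical"
  by (auto simp: canonical_times_multiplier multiplier_times_canonical
      simp flip: canonical_add canonical_diff canonical_scaleR)

text \<open>
  For \<open>x = h - r 1\<close> one has \<open>(\<bar>x\<bar> - r) (\<bar>x\<bar> + r) = x\<^sup>2 - r\<^sup>2 = h\<^sup>2 - 2 r h\<close>, which lies in the algebra, and
  \<open>\<bar>x\<bar> + r\<close> is invertible. So \<open>\<bar>x\<bar> - r\<close> lies in the algebra, and \<open>2 x\<^sub>+ = (\<bar>x\<bar> - r) + h\<close>.
\<close>

lemma pos_part_in_range_canonical: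
  fixes h :: "'a::cstar_algebra multiplier"
  assumes h: "h \<in> range canonical" "star h = h" and r: "0 < r"
  shows "pos_part (h - r *\<^sub>R 1) \<in> range canonical"
proof -
  define x where "x = h - r *\<^sub>R 1"
  have sx: "star x = x" by (simp add: x_def star_diff star_scaleR h)
  obtain k where k: "(abs_val x + r *\<^sub>R 1) * k = 1"
    using has_inverse_nonneg_add[OF nonneg_abs_val[OF sx] r] by (auto simp: has_inverse_def)
  have "(abs_val x - r *\<^sub>R 1) * (abs_val x + r *\<^sub>R 1) = x * x - (r * r) *\<^sub>R 1"
    by (simp add: algebra_simps abs_val_square[OF sx])
  also have "\<dots> = h * h - (2 * r) *\<^sub>R h"
    by (simp add: x_def algebra_simps flip: scaleR_add_left)
  finally have "abs_val x - r *\<^sub>R 1 = (h * h - (2 * r) *\<^sub>R h) * k"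
    by (metis k mult.assoc mult_1_right)
  moreover have "h * h - (2 * r) *\<^sub>R h \<in> range canonical"
    by (intro range_canonical_diff range_canonical_left range_canonical_scaleR h)
  ultimately have "abs_val x - r *\<^sub>R 1 \<in> range canonical" by (simp add: range_canonical_left)
  moreover have "pos_part x = (1/2) *\<^sub>R ((abs_val x - r *\<^sub>R 1) + h)"
    by (simp add: pos_part_def x_def)
  ultimately show ?thesis unfolding x_def[symmetric]
    by (simp only: range_canonical_scaleR range_canonical_add h)
qed

lemma nonneg_sum:
  fixes g :: "'i \<Rightarrow> 'a::cstar_algebra_1"
  shows "(\<And>i. i \<in> I \<Longrightarrow> nonneg (g i)) \<Longrightarrow> nonneg (sum g I)"
  by (induction I rule: infinite_finite_induct) (auto intro: nonneg_add nonneg_zero)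

lemma nonneg_suminf_minus:
  fixes g :: "nat \<Rightarrow> 'a::cstar_algebra_1"
  assumes "summable g" "\<And>n. nonneg (g n)"
  shows "nonneg (suminf g - g k)"
proof (rule nonneg_limit)
  show "(\<lambda>n. (\<Sum>i<n + Suc k. g i) - g k) \<longlonglongrightarrow> suminf g - g k"
    by (intro tendsto_intros LIMSEQ_ignore_initial_segment summable_LIMSEQ assms)
  have "(\<Sum>i<n + Suc k. g i) - g k = sum g ({..<n + Suc k} - {k})" for n
    by (simp add: sum_diff1)
  then show "nonneg ((\<Sum>i<n + Suc k. g i) - g k)" for n using assms(2) by (simp add: nonneg_sum)
qed

lemma bounded_linear_canonical: "bounded_linear canonical"
  by (rule bounded_linear_intro[where K = 1])
    (simp_all add: canonical_add canonical_scaleR norm_canonical)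

lemma norm_le_one_of_nonneg:
  "nonneg p \<Longrightarrow> nonneg (1 - p) \<Longrightarrow> norm (p :: 'a::cstar_algebra_1) \<le> 1"
  by (rule norm_le_of_nonneg) simp_all

text \<open>
  From an approximate identity \<open>v\<close> form \<open>h = \<Sum>\<^sub>k (1/2)\<^sup>k v k\<close> and take the cutoffs \<open>f n\<close> of \<open>h\<close>. As
  \<open>v k \<le> 2\<^sup>k h\<close>, the convergence \<open>(1 - f n) h \<rightarrow> 0\<close> forces \<open>v k (1 - f n) \<rightarrow> 0\<close> for each \<open>k\<close>, and every
  \<open>a\<close> is close to some \<open>a v k\<close>.
\<close>

lemma sigma_unital_imp_absorbing_approximate_identity:
  assumes "sigma_unital TYPE('a::cstar_algebra)"
  obtains e :: "nat \<Rightarrow> 'a::cstar_algebra" where "approximate_identity e" "\<And>n. e (Suc n) * e n = e n"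
proof -
  obtain v :: "nat \<Rightarrow> 'a" where v: "approximate_identity v"
    using assms by (auto simp: sigma_unital_def)
  define g where "g k = (1/2)^k *\<^sub>R canonical (v k)" for k
  have ng: "nonneg (g k)" for k
    using v by (simp add: g_def nonneg_scaleR approximate_identity_def positive_element_iff_nonneg)
  have "norm ((1/2)^k *\<^sub>R v k) \<le> (1/2)^k" for k
    using v by (simp add: approximate_identity_def mult_left_le)
  then have smA: "summable (\<lambda>k. (1/2)^k *\<^sub>R v k)"
    by (intro summable_comparison_test'[OF summable_geometric[of "1/2"]]) auto
  define h where "h = canonical (\<Sum>k. (1/2)^k *\<^sub>R v k)"
  have sm: "summable g" and hg: "h = suminf g"
    using bounded_linear.summable[OF bounded_linear_canonical smA]
      bounded_linear.suminf[OF bounded_linear_canonical smA]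
    by (simp_all add: g_def[abs_def] h_def canonical_scaleR)
  have hk: "nonneg (h - g k)" for k unfolding hg by (rule nonneg_suminf_minus[OF sm ng])
  have nh: "nonneg h" using nonneg_add[OF hk[of 0] ng[of 0]] by simp
  obtain f u where f: "\<And>n. f n = pos_part (h - (1/2)^n *\<^sub>R 1) * u n"
    "\<And>n. nonneg (f n)" "\<And>n. nonneg (1 - f n)" "\<And>n. nonneg (f (Suc n) - f n)"
    "\<And>n. f (Suc n) * f n = f n" "\<And>n. norm ((1 - f n) * h) \<le> 2 * (1/2)^n"
    using cutoff_sequence[OF nh] by metis
  have "f n \<in> range canonical" for n
    unfolding f(1) by (intro range_canonical_left pos_part_in_range_canonical nonneg_sa nh)
      (simp_all add: h_def)
  then have "\<exists>e. \<forall>n. f n = canonical (e n)" by (intro choice) blast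
  then obtain e where e: "\<And>n. f n = canonical (e n)" by blast
  have se: "star (e n) = e n" for n
    using nonneg_sa[OF f(2)[of n]] by (simp add: e canonical_inject flip: canonical_star)
  have mono: "nonneg (f n - f m)" if "m \<le> n" for m n
    using that
  proof (induction n rule: dec_induct)
    case (step n)
    from nonneg_add[OF step.IH f(4)[of n]] show ?case by simp
  qed (simp add: nonneg_zero)
  have nf: "norm (f n) \<le> 1" and nf': "norm (1 - f n) \<le> 1" for n
    using norm_le_one_of_nonneg[OF f(2,3)] norm_le_one_of_nonneg[OF f(3), of n] f(2)[of n] by simp_all
  \<comment> \<open>With \<open>s\<^sup>2 = v k\<close>, compare \<open>\<parallel>s (1 - f n)\<parallel>\<^sup>2 = \<parallel>(1 - f n) v k (1 - f n)\<parallel>\<close> with the same expression for \<open>2\<^sup>k h\<close>.\<close>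
  have vf: "(\<lambda>n. canonical (v k) * (1 - f n)) \<longlonglongrightarrow> 0" for k
  proof -
    have nv: "nonneg (canonical (v k))"
      using v by (simp add: approximate_identity_def positive_element_iff_nonneg)
    then obtain s where s: "star s = s" "canonical (v k) = s * s" by (auto simp: nonneg_def)
    have "nonneg (2^k *\<^sub>R (h - g k))" by (intro nonneg_scaleR hk) simp
    then have d: "nonneg (2^k *\<^sub>R h - canonical (v k))"
      by (simp add: g_def scaleR_diff_right flip: power_mult_distrib)
    have bound: "(norm (s * (1 - f n)))\<^sup>2 \<le> 2^k * (2 * (1/2)^n)" for n
    proof -
      let ?g = "1 - f n"
      have sg: "star ?g = ?g" by (rule nonneg_sa[OF f(3)])
      have "(norm (s * ?g))\<^sup>2 = norm (star ?g * canonical (v k) * ?g)"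
        by (simp add: norm_star_mult_self[symmetric] star_mult s mult.assoc)
      also have "\<dots> \<le> norm (star ?g * (2^k *\<^sub>R h) * ?g)"
      proof (rule nonneg_norm_mono)
        show "nonneg (star ?g * canonical (v k) * ?g)" by (rule nonneg_conj[OF nv])
        show "nonneg (star ?g * (2^k *\<^sub>R h) * ?g - star ?g * canonical (v k) * ?g)"
        proof -
          have conj_diff: "w * x * w' - w * y * w' = w * (x - y) * w'" for w w' x y :: "'a multiplier"
            by (simp add: left_diff_distrib right_diff_distrib)
          then show ?thesis using nonneg_conj[OF d, of ?g] by (simp only: conj_diff)
        qed
      qed
      also have "\<dots> = 2^k * norm ((?g * h) * ?g)" by (simp add: sg)
      also have "\<dots> \<le> 2^k * (norm (?g * h) * norm ?g)" by (intro mult_left_mono norm_mult_ineq) simp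
      also have "\<dots> \<le> 2^k * (2 * (1/2)^n)"
        using mult_mono[OF f(6)[of n] nf'[of n]] by simp
      finally show ?thesis .
    qed
    have "(\<lambda>n. (norm (s * (1 - f n)))\<^sup>2) \<longlonglongrightarrow> 0"
    proof (rule tendsto_sandwich[OF _ _ tendsto_const])
      have "(\<lambda>n. 2^k * (2 * (1/2)^n)) \<longlonglongrightarrow> 2^k * (2 * (0::real))"
        by (intro tendsto_intros LIMSEQ_power_zero) simp
      then show "(\<lambda>n. 2^k * (2 * (1/2)^n)) \<longlonglongrightarrow> (0::real)" by simp
    qed (use bound in auto)
    then have "(\<lambda>n. s * (1 - f n)) \<longlonglongrightarrow> 0" by (simp add: tendsto_norm_zero_iff)
    from tendsto_mult_left[OF this, of s] show ?thesis by (simp add: s mult.assoc)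
  qed
  have right: "(\<lambda>n. a * e n) \<longlonglongrightarrow> a" for a
  proof (rule LIMSEQ_I)
    fix \<epsilon> :: real assume \<epsilon>: "0 < \<epsilon>"
    have "(\<lambda>k. a * v k) \<longlonglongrightarrow> a" using v by (simp add: approximate_identity_def)
    then obtain k where k: "norm (a * v k - a) < \<epsilon> / 2"
      using LIMSEQ_D[of _ a "\<epsilon> / 2"] \<epsilon> by (metis half_gt_zero order_refl)
    have "(\<lambda>n. canonical a * (canonical (v k) * (1 - f n))) \<longlonglongrightarrow> canonical a * 0"
      by (intro tendsto_intros vf)
    then obtain N where N: "\<And>n. n \<ge> N \<Longrightarrow> norm (canonical a * (canonical (v k) * (1 - f n))) < \<epsilon> / 2"
      using LIMSEQ_D[of _ 0 "\<epsilon> / 2"] \<epsilon> by fastforce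
    have "norm (a * e n - a) < \<epsilon>" if "n \<ge> N" for n
    proof -
      have "norm (a * e n - a) = norm (canonical a * (1 - f n))"
        by (simp add: e right_diff_distrib norm_minus_commute norm_canonical
            flip: canonical_mult canonical_diff)
      also have "canonical a * (1 - f n) = canonical a * (canonical (v k) * (1 - f n))
          - canonical (a * v k - a) * (1 - f n)"
        by (simp add: canonical_diff canonical_mult algebra_simps)
      also have "norm \<dots> \<le> norm (canonical a * (canonical (v k) * (1 - f n))) +
          norm (canonical (a * v k - a)) * norm (1 - f n)"
        by (rule order_trans[OF norm_triangle_ineq4 add_left_mono[OF norm_mult_ineq]])
      also have "\<dots> < \<epsilon> / 2 + \<epsilon> / 2"
        using N[OF that] k mult_mono[OF order_refl nf', of "norm (a * v k - a)" n]
        by (simp add: norm_canonical)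
      finally show ?thesis by simp
    qed
    then show "\<exists>N. \<forall>n\<ge>N. norm (a * e n - a) < \<epsilon>" by blast
  qed
  have left: "(\<lambda>n. e n * a) \<longlonglongrightarrow> a" for a
    using bounded_linear.tendsto[OF bounded_linear_star right[of "star a"]]
    by (simp add: star_mult star_star se)
  have "approximate_identity e"
    unfolding approximate_identity_def positive_element_iff_nonneg
    using f(2) mono nf right left by (simp add: e canonical_diff norm_canonical)
  moreover have "e (Suc n) * e n = e n" for n
    using f(5)[of n] by (simp add: e canonical_inject flip: canonical_mult)
  ultimately show ?thesis by (rule that)
qed

section \<open>The Pedersen ideal\<close>

lemma two_sided_ideal_pedersen: "two_sided_ideal pedersen_ideal"
  unfolding two_sided_ideal_def pedersen_ideal_def by auto

lemma pedersen_ideal_diff: "x \<in> pedersen_ideal \<Longrightarrow> y \<in> pedersen_ideal \<Longrightarrow> x - y \<in> pedersen_ideal"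
  using two_sided_ideal_pedersen scaleC_minus_left[of 1 y]
  unfolding two_sided_ideal_def by (metis diff_conv_add_uminus scaleC_one)

text \<open>
  Let \<open>i\<close> be an element of a dense ideal with \<open>h = b - i\<close> of norm less than \<open>1\<close>, and \<open>k = (1 - h)\<^sup>-\<^sup>1\<close>.
  Then \<open>a = a i k\<close>, as \<open>a (1 - h) = a i\<close>. To see that this lies in the ideal although \<open>k\<close> is only a multiplier, write \<open>k = 1 + g\<close>
  with \<open>g = h k\<close> in the algebra.
\<close>

lemma mem_pedersen_ideal_of_absorbed:
  fixes a b :: "'a::cstar_algebra"
  assumes ab: "a * b = a"
  shows "a \<in> pedersen_ideal"
  unfolding pedersen_ideal_def
proof (intro InterI, elim CollectE conjE)
  fix I :: "'a set" assume I: "two_sided_ideal I" and "closure I = UNIV"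
  then obtain i where i: "i \<in> I" "dist i b < 1" by (metis UNIV_I closure_approachable zero_less_one)
  define h where "h = b - i"
  have "norm (canonical h) < 1"
    using i(2) by (simp add: h_def norm_canonical dist_norm norm_minus_commute)
  then obtain k where k: "(1 - canonical h) * k = 1"
    using has_inverse_one_minus by (auto simp: has_inverse_def)
  define g where "g = rmul k h"
  have "k = 1 + canonical h * k" using k by (simp add: left_diff_distrib diff_eq_eq)
  then have kg: "k = 1 + canonical g" by (simp add: g_def canonical_times_multiplier)
  have "canonical (a * i) = canonical a * (1 - canonical h)"
    by (simp add: h_def right_diff_distrib ab flip: canonical_mult canonical_diff)
  then have "canonical (a * i) * k = canonical a" by (simp add: mult.assoc k)
  then have "canonical a = canonical (a * i + a * i * g)"
    by (simp add: kg distrib_left canonical_add canonical_mult)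
  then have "a = a * i + a * i * g" by (simp add: canonical_inject)
  then show "a \<in> I" using I i(1) unfolding two_sided_ideal_def by metis
qed

section \<open>Sparse subsequences and strict sums\<close>

text \<open>
  The multiplier \<open>X\<close> maps each \<open>e m\<close> into the algebra, where \<open>e n\<close> tends to act as the identity. So \<open>\<nu> (k + 1)\<close> can be found
  once \<open>\<nu> k\<close> is given.
\<close>

lemma almost_commuting_subsequence:
  fixes e :: "nat \<Rightarrow> 'a::cstar_algebra"
  assumes e: "approximate_identity e" and \<eta>: "0 < \<eta>"
  obtains \<nu> where "strict_mono \<nu>"
    "\<And>k. norm ((1 - canonical (e (\<nu> (Suc k)))) * X * canonical (e (\<nu> k))) \<le> \<eta> * (1/2)^k"
proof -
  have ex: "\<exists>n>m. norm ((1 - canonical (e n)) * X * canonical (e m)) \<le> \<eta> * (1/2)^k" for m k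
  proof -
    let ?b = "lmul X (e m)"
    have eq: "norm ((1 - canonical (e n)) * X * canonical (e m)) = norm (?b - e n * ?b)" for n
    proof -
      have "(1 - canonical (e n)) * X * canonical (e m) = (1 - canonical (e n)) * canonical ?b"
        by (simp only: mult.assoc multiplier_times_canonical[of X])
      also have "\<dots> = canonical (?b - e n * ?b)"
        by (simp add: left_diff_distrib canonical_diff canonical_mult)
      finally show ?thesis by (simp only: norm_canonical)
    qed
    have "(\<lambda>n. e n * ?b) \<longlonglongrightarrow> ?b" using e by (simp add: approximate_identity_def)
    moreover have "0 < \<eta> * (1/2)^k" using \<eta> by simp
    ultimately obtain N where "\<And>n. n \<ge> N \<Longrightarrow> norm (e n * ?b - ?b) < \<eta> * (1/2)^k"
      using LIMSEQ_D by blast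
    from this[of "max N (Suc m)"] show ?thesis unfolding eq
      by (intro exI[of _ "max N (Suc m)"]) (simp add: norm_minus_commute)
  qed
  have "\<exists>\<nu>. \<forall>k. True \<and> \<nu> k < \<nu> (Suc k) \<and>
      norm ((1 - canonical (e (\<nu> (Suc k)))) * X * canonical (e (\<nu> k))) \<le> \<eta> * (1/2)^k"
    by (rule dependent_nat_choice) (use ex in auto)
  then show ?thesis using that by (metis strict_mono_Suc_iff)
qed

lemma strict_sums_iff:
  "strict_sums d S \<longleftrightarrow>
    (\<forall>b. (\<lambda>n. (\<Sum>k<n. d k) * b) \<longlonglongrightarrow> lmul S b \<and> (\<lambda>n. b * (\<Sum>k<n. d k)) \<longlonglongrightarrow> rmul S b)"
proof -
  have "(\<Sum>k<n. canonical (d k)) = canonical (\<Sum>k<n. d k)" for n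
    by (rule linear_sum[OF bounded_linear.linear[OF bounded_linear_canonical], symmetric])
  then show ?thesis by (simp add: strict_sums_def limitin_strict_topology_iff)
qed

lemma strict_sums_shift:
  assumes "strict_sums d S"
  shows "strict_sums (\<lambda>k. d (N + k)) (S - canonical (\<Sum>k<N. d k))"
proof -
  have eq: "(\<Sum>k<n. d (N + k)) = (\<Sum>k<n + N. d k) - (\<Sum>k<N. d k)" for n
    by (induction n) (simp_all add: add.commute)
  have "(\<lambda>n. (\<Sum>k<n + N. d k) * b) \<longlonglongrightarrow> lmul S b" "(\<lambda>n. b * (\<Sum>k<n + N. d k)) \<longlonglongrightarrow> rmul S b" for b
    using assms LIMSEQ_ignore_initial_segment[of "\<lambda>n. (\<Sum>k<n. d k) * b" _ N]
      LIMSEQ_ignore_initial_segment[of "\<lambda>n. b * (\<Sum>k<n. d k)" _ N]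
    unfolding strict_sums_iff by auto
  then show ?thesis
    unfolding strict_sums_iff eq left_diff_distrib right_diff_distrib
    by (simp add: blinfun.diff_left tendsto_diff)
qed

lemma canonical_mult_strict_sum_eq_0:
  fixes d :: "nat \<Rightarrow> 'a::cstar_algebra"
  assumes R: "strict_sums d R" and c: "\<And>k. c * d k = 0"
  shows "canonical c * R = 0"
proof -
  have 0: "c * (\<Sum>k<n. d k) = 0" for n by (simp add: sum_distrib_left c)
  have "(\<lambda>n. c * (\<Sum>k<n. d k)) \<longlonglongrightarrow> rmul R c" using R unfolding strict_sums_iff by blast
  then have "rmul R c = 0" unfolding 0 using LIMSEQ_unique tendsto_const by blast
  then show ?thesis by (simp add: canonical_times_multiplier canonical_zero)
qed

section \<open>The bidiagonal decomposition\<close>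

text \<open>
  The first term is \<open>0\<close> so that the slabs below telescope from \<open>0\<close>, and so that the lower end \<open>f (3 k - 1)\<close> of the
  window at \<open>k = 0\<close>, with truncated subtraction, is \<open>0\<close> as well.
\<close>

locale absorbing_sequence =
  fixes f :: "nat \<Rightarrow> 'a::cstar_algebra"
  assumes start: "f 0 = 0"
    and absorb: "i < j \<Longrightarrow> f j * f i = f i"
    and increasing: "i \<le> j \<Longrightarrow> nonneg (canonical (f j - f i))"
    and contraction: "norm (f j) \<le> 1"
    and approximates: "(\<lambda>j. f j * a) \<longlonglongrightarrow> a"
begin

abbreviation "F j \<equiv> canonical (f j)"

text \<open>The element \<open>X (f\<^bsub>3k+3\<^esub> - f\<^bsub>3k\<^esub>) X\<close> of the algebra, as \<open>canonical_slab\<close> shows.\<close>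

definition "slab X k = rmul X (lmul X (f (3 * k + 3) - f (3 * k)))"

text \<open>
  The window extends beyond the \<open>k\<close>-th slab by one index on both sides. The step width \<open>3\<close> is the least for
  which windows at distance \<open>2\<close> are still orthogonal: the upper end \<open>3 k + 4\<close> is below the lower end
  \<open>3 (k + 2) - 1\<close>.
\<close>

definition "window k = f (3 * k + 4) - f (3 * k - 1)"

definition "block X k = window k * slab X k * window k"

lemma nonneg_F: "nonneg (F j)"
  using increasing[of 0 j] by (simp add: start)

lemma star_F: "star (F j) = F j"
  by (rule nonneg_sa[OF nonneg_F])

lemma star_f: "star (f j) = f j"
  using star_F[of j] by (simp add: canonical_inject flip: canonical_star)

lemma absorb': "i < j \<Longrightarrow> f i * f j = f i"
  using arg_cong[OF absorb, of i j star] by (simp add: star_mult star_f)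

lemma approximates': "(\<lambda>j. a * f j) \<longlonglongrightarrow> a"
  using bounded_linear.tendsto[OF bounded_linear_star approximates[of "star a"]]
  by (simp add: star_mult star_star star_f)

lemma norm_F: "norm (F j) \<le> 1"
  by (simp add: norm_canonical contraction)

lemma norm_one_minus_F: "norm (1 - F j) \<le> 1"
  using nonneg_norm_diff_le[OF nonneg_F norm_F, of j] by simp

lemma window_mult_window:
  assumes "n + 2 \<le> m"
  shows "window m * window n = 0" "window n * window m = 0"
proof -
  have lt: "3 * n + 4 < 3 * m + 4" "3 * n + 4 < 3 * m - 1" "3 * n - 1 < 3 * m + 4" "3 * n - 1 < 3 * m - 1"
    using assms by linarith+
  show "window m * window n = 0"
    by (simp only: window_def left_diff_distrib right_diff_distrib lt[THEN absorb]) simp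
  show "window n * window m = 0"
    by (simp only: window_def left_diff_distrib right_diff_distrib lt[THEN absorb']) simp
qed

lemma block_mult_block:
  assumes "\<bar>int n - int m\<bar> \<ge> 2"
  shows "block X n * block X m = 0"
proof -
  have "window n * window m = 0"
    using window_mult_window[of n m] window_mult_window[of m n] assms by linarith
  then have "window n * (window m * y) = 0" for y by (simp flip: mult.assoc)
  then show ?thesis by (simp add: block_def mult.assoc)
qed

lemma canonical_slab: "canonical (slab X k) = X * (F (3 * k + 3) - F (3 * k)) * X"
  by (simp add: slab_def canonical_diff flip: canonical_times_multiplier multiplier_times_canonical)

lemma canonical_window: "canonical (window k) = F (3 * k + 4) - F (3 * k - 1)"
  by (simp add: window_def canonical_diff)

lemma positive_block:
  assumes X: "star X = X"
  shows "positive_element (block X k)"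
proof -
  let ?Q = "canonical (window k)"
  have "star ?Q = ?Q" by (simp add: canonical_window star_diff star_F)
  moreover have "nonneg (F (3 * k + 3) - F (3 * k))"
    using increasing[of "3 * k" "3 * k + 3"] by (simp add: canonical_diff)
  ultimately show ?thesis
    using nonneg_conj[of "F (3 * k + 3) - F (3 * k)" "X * ?Q"]
    by (simp add: positive_element_iff_nonneg block_def canonical_mult canonical_slab star_mult X mult.assoc)
qed

lemma star_slab_minus_block:
  assumes X: "star X = X"
  shows "star (slab X k - block X k) = slab X k - block X k"
proof -
  have "star (canonical (slab X k)) = canonical (slab X k)"
    by (simp add: canonical_slab star_mult star_diff star_F X mult.assoc)
  moreover have "star (block X k) = block X k"
    using positive_block[OF X] by (simp add: positive_element_def selfadjoint_def)
  ultimately show ?thesis by (simp add: star_diff canonical_inject flip: canonical_star)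
qed

text \<open>
  The complement of the window consists of an upper part \<open>1 - f\<^bsub>3k+4\<^esub>\<close> and a lower part \<open>f\<^bsub>3k-1\<^esub>\<close>. By absorption
  \<open>f\<^bsub>3k+3\<^esub> - f\<^bsub>3k\<^esub>\<close> has \<open>f\<^bsub>3k+3\<^esub>\<close> as left factor, which controls the upper part, and also
  \<open>1 - f\<^bsub>3k\<^esub>\<close>, which controls the lower part after taking adjoints.
\<close>

lemma norm_off_window:
  assumes X: "star X = X" and tail: "\<And>j. norm ((1 - F (Suc j)) * X * F j) \<le> \<eta> * (1/2)^j"
  shows "norm ((1 - canonical (window k)) * X * (F (3 * k + 3) - F (3 * k))) \<le> 2 * \<eta> * (1/2)^k"
proof -
  have \<eta>: "0 \<le> \<eta>" using order_trans[OF norm_ge_zero tail[of 0]] by simp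
  have decay: "\<eta> * (1/2)^j \<le> \<eta> * (1/2)^k" if "k \<le> j" for j
    using \<eta> that by (intro mult_left_mono power_decreasing) auto
  let ?G = "F (3 * k + 3)" and ?H = "F (3 * k)" and ?U = "F (3 * k + 4)" and ?L = "F (3 * k - 1)"
  have GH: "?G * ?H = ?H" "?H * ?G = ?H"
    using absorb[of "3 * k" "3 * k + 3"] absorb'[of "3 * k" "3 * k + 3"]
    by (simp_all flip: canonical_mult)
  have "(1 - canonical (window k)) * X * (?G - ?H) = (1 - ?U) * X * (?G - ?H) + ?L * X * (?G - ?H)"
    by (simp add: canonical_window algebra_simps)
  also have "(1 - ?U) * X * (?G - ?H) = (1 - ?U) * X * ?G * (1 - ?H)"
    by (simp add: right_diff_distrib mult.assoc GH)
  also have "?L * X * (?G - ?H) = ?L * X * (1 - ?H) * ?G"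
    by (simp add: right_diff_distrib left_diff_distrib mult.assoc GH)
  also have "norm ((1 - ?U) * X * ?G * (1 - ?H) + ?L * X * (1 - ?H) * ?G)
      \<le> norm ((1 - ?U) * X * ?G) * norm (1 - ?H) + norm (?L * X * (1 - ?H)) * norm ?G"
    by (rule order_trans[OF norm_triangle_ineq add_mono[OF norm_mult_ineq norm_mult_ineq]])
  also have "\<dots> \<le> norm ((1 - ?U) * X * ?G) + norm (?L * X * (1 - ?H))"
    using mult_left_le[OF norm_one_minus_F, of "norm ((1 - ?U) * X * ?G)" "3 * k"]
      mult_left_le[OF norm_F, of "norm (?L * X * (1 - ?H))" "3 * k + 3"] by simp
  also have "norm ((1 - ?U) * X * ?G) \<le> \<eta> * (1/2)^k"
    using tail[of "3 * k + 3"] decay[of "3 * k + 3"] by (simp add: eval_nat_numeral)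
  also have "norm (?L * X * (1 - ?H)) \<le> \<eta> * (1/2)^k"
  proof (cases k)
    case 0
    then show ?thesis using \<eta> by (simp add: start canonical_zero)
  next
    case (Suc i)
    then have "3 * k = Suc (3 * k - 1)" "k \<le> 3 * k - 1" by simp_all
    then have "norm ((1 - ?H) * X * ?L) \<le> \<eta> * (1/2)^k"
      using tail[of "3 * k - 1"] decay[of "3 * k - 1"] by simp
    moreover have "star (?L * X * (1 - ?H)) = (1 - ?H) * X * ?L"
      by (simp add: star_mult star_diff star_F X mult.assoc)
    ultimately show ?thesis by (metis norm_star)
  qed
  finally show ?thesis by simp
qed

lemma norm_slab_minus_block:
  assumes X: "star X = X" and tail: "\<And>j. norm ((1 - F (Suc j)) * X * F j) \<le> \<eta> * (1/2)^j"
  shows "norm (slab X k - block X k) \<le> 6 * \<eta> * norm X * (1/2)^k"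
proof -
  let ?Q = "canonical (window k)" and ?R = "F (3 * k + 3) - F (3 * k)"
  have sQ: "star ?Q = ?Q" by (simp add: canonical_window star_diff star_F)
  have b: "norm ((1 - ?Q) * X * ?R) \<le> 2 * \<eta> * (1/2)^k" by (rule norm_off_window[OF X tail])
  then have b': "norm (?R * X * (1 - ?Q)) \<le> 2 * \<eta> * (1/2)^k"
    using norm_star[of "(1 - ?Q) * X * ?R"]
    by (simp add: star_mult star_diff star_F X sQ mult.assoc)
  have nQ: "norm ?Q \<le> 2"
    using norm_triangle_ineq4[of "F (3 * k + 4)" "F (3 * k - 1)"] norm_F[of "3 * k + 4"]
      norm_F[of "3 * k - 1"] by (simp add: canonical_window)
  have "canonical (slab X k - block X k) = (1 - ?Q) * X * ?R * X + ?Q * X * (?R * X * (1 - ?Q))"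
  proof -
    have "canonical (slab X k - block X k) = X * ?R * X - ?Q * (X * ?R * X) * ?Q"
      by (simp add: canonical_diff block_def canonical_mult canonical_slab)
    also have "\<dots> = (1 - ?Q) * X * ?R * X + ?Q * X * (?R * X * (1 - ?Q))"
    proof -
      have "x * r * x - q * (x * r * x) * q = (1 - q) * x * r * x + q * x * (r * x * (1 - q))"
        for x r q :: "'a multiplier" by (simp add: algebra_simps)
      then show ?thesis .
    qed
    finally show ?thesis .
  qed
  then have "norm (slab X k - block X k)
      \<le> norm ((1 - ?Q) * X * ?R * X) + norm (?Q * X * (?R * X * (1 - ?Q)))"
    by (metis norm_canonical norm_triangle_ineq)
  also have "norm ((1 - ?Q) * X * ?R * X) \<le> 2 * \<eta> * (1/2)^k * norm X"
    by (rule order_trans[OF norm_mult_ineq mult_right_mono[OF b]]) simp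
  also have "norm (?Q * X * (?R * X * (1 - ?Q))) \<le> norm (?Q * X) * (2 * \<eta> * (1/2)^k)"
    by (rule order_trans[OF norm_mult_ineq mult_left_mono[OF b']]) simp
  also have "\<dots> \<le> (2 * norm X) * (2 * \<eta> * (1/2)^k)"
  proof (rule mult_right_mono)
    show "norm (?Q * X) \<le> 2 * norm X"
      by (rule order_trans[OF norm_mult_ineq mult_right_mono[OF nQ]]) simp
    show "0 \<le> 2 * \<eta> * (1/2)^k" using b norm_ge_zero order_trans by blast
  qed
  finally show ?thesis by (simp add: algebra_simps)
qed

lemma sum_slab: "(\<Sum>k<n. slab X k) = rmul X (lmul X (f (3 * n)))"
proof (induction n)
  case 0
  show ?case by (simp add: start blinfun.zero_right)
next
  case (Suc n)
  then show ?case by (simp add: slab_def blinfun.diff_right add.commute)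
qed

text \<open>
  The sum of the slabs is \<open>X f\<^bsub>3n\<^esub> X\<close>, which tends to \<open>X\<^sup>2\<close> strictly, and replacing slabs by blocks changes
  the sum by a norm convergent series.
\<close>

theorem bidiagonal_decomposition:
  assumes X: "star X = X" and tail: "\<And>j. norm ((1 - F (Suc j)) * X * F j) \<le> \<eta> * (1/2)^j"
  obtains S a where "bidiagonal_series (block X)" "strict_sums (block X) S"
    "selfadjoint a" "norm a \<le> 12 * \<eta> * norm X" "X * X = S + canonical a"
proof -
  let ?c = "\<lambda>k. slab X k - block X k"
  have g: "summable (\<lambda>k. 6 * \<eta> * norm X * (1/2)^k)" by (intro summable_mult summable_geometric) simp
  note le = norm_slab_minus_block[OF X tail]
  have sm: "summable ?c" by (rule summable_comparison_test'[OF g le])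
  define a where "a = (\<Sum>k. ?c k)"
  have "star a = a"
    using bounded_linear.suminf[OF bounded_linear_star sm]
    by (simp only: a_def star_slab_minus_block[OF X])
  then have sa: "selfadjoint a" by (simp add: selfadjoint_def)
  have "norm a \<le> (\<Sum>k. 6 * \<eta> * norm X * (1/2)^k)" unfolding a_def by (rule norm_suminf_le[OF le g])
  also have "\<dots> = 12 * \<eta> * norm X" by (subst suminf_mult) (simp_all add: suminf_geometric)
  finally have na: "norm a \<le> 12 * \<eta> * norm X" .
  define S where "S = X * X - canonical a"
  have "strict_sums (block X) S"
    unfolding strict_sums_iff
  proof (intro allI conjI)
    fix b
    have mono: "strict_mono (\<lambda>n::nat. 3 * n)" by (rule strict_monoI) simp
    have part: "(\<Sum>k<n. block X k) = rmul X (lmul X (f (3 * n))) - (\<Sum>k<n. ?c k)" for n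
      by (simp add: sum_subtractf sum_slab)
    have c: "(\<lambda>n. \<Sum>k<n. ?c k) \<longlonglongrightarrow> a" unfolding a_def by (rule summable_LIMSEQ[OF sm])
    have "(\<lambda>n. f (3 * n) * lmul X b) \<longlonglongrightarrow> lmul X b"
      using LIMSEQ_subseq_LIMSEQ[OF approximates mono] by (simp add: o_def)
    from tendsto_diff[OF blinfun.tendsto[OF tendsto_const this, of "lmul X"] tendsto_mult_right[OF c]]
    show "(\<lambda>n. (\<Sum>k<n. block X k) * b) \<longlonglongrightarrow> lmul S b"
      unfolding part by (simp add: S_def left_diff_distrib rmul_lmul lmul_mult blinfun.diff_left)
    have "(\<lambda>n. rmul X b * f (3 * n)) \<longlonglongrightarrow> rmul X b"
      using LIMSEQ_subseq_LIMSEQ[OF approximates' mono] by (simp add: o_def)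
    from tendsto_diff[OF blinfun.tendsto[OF tendsto_const this, of "rmul X"] tendsto_mult_left[OF c]]
    show "(\<lambda>n. b * (\<Sum>k<n. block X k)) \<longlonglongrightarrow> rmul S b"
      unfolding part by (simp add: S_def right_diff_distrib rmul_lmul rmul_mult blinfun.diff_left
          flip: rmul_mult rmul_lmul)
  qed
  moreover from this have "bidiagonal_series (block X)"
    unfolding bidiagonal_series_def using positive_block[OF X] block_mult_block by blast
  ultimately show ?thesis using that sa na by (simp add: S_def)
qed

end

text \<open>
  The decomposition for the root \<open>X\<close> of \<open>T\<close> and a sparse subsequence of \<open>e\<close>, preceded by \<open>0\<close>. Each \<open>f j\<close> is absorbed by
  \<open>f (j + 1)\<close> and so lies in the Pedersen ideal, and \<open>e n\<close> is absorbed by \<open>f j\<close> for \<open>j \<ge> n + 2\<close>, hence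
  annihilates the windows from index \<open>n + 1\<close> on.
\<close>

lemma absorbing_bidiagonal_decomposition:
  fixes T :: "'a::cstar_algebra multiplier"
  assumes T: "positive_element T" and e: "approximate_identity e" "\<And>n. e (Suc n) * e n = e n"
    and \<epsilon>: "0 < \<epsilon>"
  obtains d S a where "bidiagonal_series d" "strict_sums d S" "selfadjoint a" "norm a < \<epsilon>"
    "T = S + canonical a" "\<And>k. d k \<in> pedersen_ideal"
    "\<And>n. \<exists>N R. strict_sums (\<lambda>k. d (N + k)) R \<and> canonical (e n) * R = 0"
proof -
  obtain X where X: "star X = X" "T = X * X"
    using nonneg_of_positive_element[OF T] by (auto simp: nonneg_def)
  define \<eta> where "\<eta> = \<epsilon> / (12 * (norm X + 1))"
  have "0 < norm X + 1" by (simp add: add_nonneg_pos)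
  then have \<eta>: "0 < \<eta>" "12 * \<eta> * norm X < \<epsilon>" using \<epsilon> by (simp_all add: \<eta>_def field_simps)
  obtain \<nu> where \<nu>: "strict_mono \<nu>"
    "\<And>k. norm ((1 - canonical (e (\<nu> (Suc k)))) * X * canonical (e (\<nu> k))) \<le> (\<eta>/2) * (1/2)^k"
    using almost_commuting_subsequence[OF e(1), of "\<eta>/2" X] \<eta>(1) by auto
  define f where "f j = (case j of 0 \<Rightarrow> 0 | Suc i \<Rightarrow> e (\<nu> i))" for j
  have f0: "f 0 = 0" and fS: "f (Suc i) = e (\<nu> i)" for i by (simp_all add: f_def)
  have pd: "positive_element (e n - e m)" if "m \<le> n" for m n
    using e(1) that by (auto simp: approximate_identity_def)
  have pe: "positive_element (e n)" and ne: "norm (e n) \<le> 1" for n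
    using e(1) by (auto simp: approximate_identity_def)
  have se: "star (e n) = e n" for n
    using pe[of n] by (auto simp: positive_element_def selfadjoint_def)
  have ee: "e n * e m = e m" if "m < n" for m n
    using that
  proof (induction n)
    case (Suc n)
    show ?case
    proof (cases "m = n")
      case True
      then show ?thesis by (simp add: e)
    next
      case False
      with Suc have "e n * e m = e m" by simp
      then show ?thesis by (metis e(2) mult.assoc)
    qed
  qed simp
  have ee': "e m * e n = e m" if "m < n" for m n
    using arg_cong[OF ee[OF that], of star] by (simp add: star_mult se)
  interpret absorbing_sequence f
  proof
    show "f 0 = 0" by (rule f0)
    show "f j * f i = f i" if "i < j" for i j
      using that ee strict_monoD[OF \<nu>(1)] by (cases i; cases j) (simp_all add: f0 fS)
    show "nonneg (canonical (f j - f i))" if "i \<le> j" for i j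
      using that pd pe strict_mono_less_eq[OF \<nu>(1)]
      by (cases i; cases j) (simp_all add: f0 fS canonical_zero nonneg_zero flip: positive_element_iff_nonneg)
    show "norm (f j) \<le> 1" for j using ne by (cases j) (auto simp: f0 fS)
    show "(\<lambda>j. f j * a) \<longlonglongrightarrow> a" for a
    proof (rule LIMSEQ_imp_Suc)
      have "(\<lambda>n. e n * a) \<longlonglongrightarrow> a" using e(1) by (simp add: approximate_identity_def)
      from LIMSEQ_subseq_LIMSEQ[OF this \<nu>(1)] show "(\<lambda>j. f (Suc j) * a) \<longlonglongrightarrow> a"
        by (simp add: fS o_def)
    qed
  qed
  have "norm ((1 - F (Suc j)) * X * F j) \<le> \<eta> * (1/2)^j" for j
    using \<eta>(1) \<nu>(2) by (cases j) (simp_all add: f0 fS canonical_zero)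
  from bidiagonal_decomposition[OF X(1) this] obtain S a where S:
    "bidiagonal_series (block X)" "strict_sums (block X) S" "selfadjoint a"
    "norm a \<le> 12 * \<eta> * norm X" "X * X = S + canonical a" by metis
  show ?thesis
  proof (rule that[OF S(1-3)])
    show "norm a < \<epsilon>" using S(4) \<eta>(2) by simp
    show "T = S + canonical a" using S(5) X(2) by simp
    have ideal: "x * y \<in> pedersen_ideal" "y * x \<in> pedersen_ideal" if "x \<in> pedersen_ideal" for x y :: 'a
      using two_sided_ideal_pedersen that unfolding two_sided_ideal_def by blast+
    have "f j \<in> pedersen_ideal" for j
      using mem_pedersen_ideal_of_absorbed[of "f j" "f (Suc j)"] absorb'[of j "Suc j"] by simp
    then have "window k \<in> pedersen_ideal" for k by (simp add: window_def pedersen_ideal_diff)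
    then show "block X k \<in> pedersen_ideal" for k by (simp add: block_def ideal)
    fix n
    have en: "e n * f j = e n" if "n + 2 \<le> j" for j
    proof (cases j)
      case (Suc i)
      then have "n < \<nu> i" using that strict_mono_imp_increasing[OF \<nu>(1), of i] by simp
      then show ?thesis by (simp add: Suc fS ee')
    qed (use that in simp)
    have "e n * window (Suc n + k) = 0" for k
      by (simp add: window_def right_diff_distrib en)
    then have "e n * block X (Suc n + k) = 0" for k by (simp add: block_def flip: mult.assoc)
    then have "canonical (e n) * (S - canonical (\<Sum>k<Suc n. block X k)) = 0"
      by (rule canonical_mult_strict_sum_eq_0[OF strict_sums_shift[OF S(2)]])
    then show "\<exists>N R. strict_sums (\<lambda>k. block X (N + k)) R \<and> canonical (e n) * R = 0"
      using strict_sums_shift[OF S(2)] by blast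
  qed
qed

theorem theorem4p2:
  fixes T :: "'a::cstar_algebra multiplier"
  assumes "sigma_unital TYPE('a)"
    and "positive_element T"
  shows "(\<forall>\<epsilon>>0. \<exists>(d :: nat \<Rightarrow> 'a) S a.
            bidiagonal_series d \<and> strict_sums d S \<and>
            selfadjoint a \<and> norm a < \<epsilon> \<and> T = S + canonical a) \<and>
         (\<forall>e :: nat \<Rightarrow> 'a. approximate_identity e \<and> (\<forall>n. e (Suc n) * e n = e n) \<longrightarrow>
           (\<forall>\<epsilon>>0. \<exists>(d :: nat \<Rightarrow> 'a) S a.
              bidiagonal_series d \<and> strict_sums d S \<and>
              selfadjoint a \<and> norm a < \<epsilon> \<and> T = S + canonical a \<and>
              (\<forall>k. d k \<in> pedersen_ideal) \<and>
              (\<forall>n. \<exists>N R. strict_sums (\<lambda>k. d (N + k)) R \<and> canonical (e n) * R = 0)))"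
proof (intro conjI allI impI)
  fix \<epsilon> :: real assume \<epsilon>: "0 < \<epsilon>"
  obtain e :: "nat \<Rightarrow> 'a" where e: "approximate_identity e" "\<And>n. e (Suc n) * e n = e n"
    using sigma_unital_imp_absorbing_approximate_identity[OF assms(1)] by blast
  show "\<exists>(d :: nat \<Rightarrow> 'a) S a. bidiagonal_series d \<and> strict_sums d S \<and>
      selfadjoint a \<and> norm a < \<epsilon> \<and> T = S + canonical a"
    by (rule absorbing_bidiagonal_decomposition[OF assms(2) e \<epsilon>]) blast
next
  fix e :: "nat \<Rightarrow> 'a" and \<epsilon> :: real
  assume "approximate_identity e \<and> (\<forall>n. e (Suc n) * e n = e n)" and \<epsilon>: "0 < \<epsilon>"
  then have e: "approximate_identity e" "\<And>n. e (Suc n) * e n = e n" by auto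
  show "\<exists>(d :: nat \<Rightarrow> 'a) S a. bidiagonal_series d \<and> strict_sums d S \<and>
      selfadjoint a \<and> norm a < \<epsilon> \<and> T = S + canonical a \<and> (\<forall>k. d k \<in> pedersen_ideal) \<and>
      (\<forall>n. \<exists>N R. strict_sums (\<lambda>k. d (N + k)) R \<and> canonical (e n) * R = 0)"
    by (rule absorbing_bidiagonal_decomposition[OF assms(2) e \<epsilon>]) blast
qed

end
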